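(* Let $\varepsilon>0$ and let $y$ be the dual solution produced by the $\varepsilon$-extended moat-growing algorithm. There exist a collection $\mathcal{S}$ of actively connected vertex sets and a crossing-free autarkic collection $\mathcal{P}$ such that $$\tfrac{10}{3}\big(\mathrm{gain}(\mathcal{S})-\mathrm{cost}(\mathcal{S})\big)+\big(2\,\mathrm{coverage}(\mathcal{P})-\mathrm{cost}(\mathcal{P})\big)+\Big(\tfrac{1}{2\varepsilon}+17\Big)\mathrm{excess}(\mathrm{OPT})\ \ge\ y(\mathcal{U}_{\mathrm{sep}}).$$
   Context: Steiner Forest: given a finite undirected graph $G=(V,E)$ with non-negative edge costs $(c_e)_{e\in E}$ and a set $\mathcal{D}$ of demand pairs $\{a,b\}\subseteq V$ (partners), a feasible solution is $F\subseteq E$ such that each demand pair lies in one connected component of $(V,F)$; $c(F)=\sum_{e\in F}c_e$. $\mathrm{OPT}$ is a fixed optimal solution that is inclusionwise minimal (no cost-$0$ edge of it can be omitted while keeping feasibility). For $U\subseteq V$, $\delta(U)$ is the set of edges with exactly one endpoint in $U$; $U$ separates $S$ if $S\cap U\ne\emptyset$ and $S\setminus U\ne\emptyset$; $\mathrm{sep}(U)$ is the set of demand pairs separated by $U$. The $\varepsilon$-extended moat-growing algorithm: time $t$ increases continuously from $0$ at unit rate. It maintains tight edges $F$ (initially empty), duals $y_S(t)\ge0$ (initially $0$), and budgets $b_S(t)\ge0$ of components (initially $0$). $\mathcal{C}^t$ is the family of vertex sets of connected components of $(V,F)$. A component is demand-active if it contains a vertex not connected in $(V,F)$ to some partner; budget-active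 if not demand-active but with positive budget; active if either; $\mathcal{A}^t$ is the set of active components. Each $y_S$ with $S\in\mathcal{A}^t$ grows at unit rate; budgets of demand-active components grow at rate $\varepsilon$, of budget-active ones decrease at rate $1$. An edge $e$ with $\sum_{S:e\in\delta(S)}y_S(t)=c_e$ becomes tight and is added to $F$; merging components add budgets. $y_S=y_S(\infty)$; $\mathcal{U}_{\mathrm{sep}}$ is the set of $U\in\mathrm{supp}(y)$ separating some demand pair; $y(\mathcal{U}')=\sum_{U\in\mathcal{U}'}y_U$; $\mathrm{excess}(F)=c(F)-y(\mathcal{U}_{\mathrm{sep}})$. The deactivation time $\tau_v$ of $v$ is the largest $t$ such that for all $s<t$, $v$ lies in a set of $\mathcal{A}^s$. Vertices $u,v$ are actively connected if for some $t$ they lie in a common set of $\mathcal{C}^t$ and $\tau_u,\tau_v\ge t$; a set is actively connected if contained in one equivalence class of this equivalence relation. For a collection $\mathcal{S}$ of actively connected sets, $\mathcal{A}^t/\mathcal{S}$ arises from $\mathcal{A}^t$ by merging sets intersected by the same $S\in\mathcal{S}$ (transitively), and $\mathrm{gain}(\mathcal{S})=2\int_0^\infty(|\mathcal{A}^t|-|\mathcal{A}^t/\mathcal{S}|)\,dt$. $\mathrm{cost}(S)$ is the minimum cost of an edge set connecting all vertices of $S$ in one component; $\mathrm{cost}(\mathcal{S})=\sum_{S\in\mathcal{S}}\mathrm{cost}(S)$. Autarkic pair: $\{A,B\}$ with $A,B\in\mathrm{supp}(y)$ disjoint, both in $\mathcal{A}^t$ for some $t$, $\mathrm{sep}(A)=\mathrm{sep}(B)\ne\emptyset$;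 its $\mathrm{sep}$ is $\mathrm{sep}(A)$. Autarkic triple: $\{A_1,A_2,A_3\}$ pairwise disjoint, all in $\mathcal{A}^t$ for some $t$, each $\mathrm{sep}(A_i)\ne\emptyset$, $\mathrm{sep}(A_1\cup A_2\cup A_3)=\emptyset$; its $\mathrm{sep}$ is $\bigcup_i\mathrm{sep}(A_i)$. An autarkic collection (set of pairs/triples) is crossing-free if the $\mathrm{sep}$'s of distinct members are disjoint. $U\in\mathrm{supp}(y)$ is covered by $\mathcal{P}$ if some member of $\mathcal{P}$ contains a set $A$ with $\mathrm{sep}(A)=\mathrm{sep}(U)$; $\mathrm{coverage}(\mathcal{P})$ is the sum of $y_U$ over covered $U$. Connectors: for a pair, pick a designated representative demand pair $\{a,b\}$ in its $\mathrm{sep}$ and connect $a,b$ directly (shortest path); for a triple, for each $i\ne j$ with $\mathrm{sep}(A_i)\cap\mathrm{sep}(A_j)\ne\emptyset$ pick a designated demand pair there, and take a minimum Steiner tree on all representative vertices. $\mathrm{cost}(P)$ is the connector's length and $\mathrm{cost}(\mathcal{P})=\sum_{P\in\mathcal{P}}\mathrm{cost}(P)$. *)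

theory Defs
  imports "HOL-Analysis.Analysis"
begin

text \<open>A Steiner Forest instance: vertex set, edge set (an abstract edge type, so that
parallel edges are allowed), endpoint map, edge costs, demand pairs.\<close>
record ('a, 'e) sf_inst =
  V :: "'a set"
  Ed :: "'e set"
  ends :: "'e \<Rightarrow> 'a set"
  cost :: "'e \<Rightarrow> real"
  dem :: "'a set set"

definition wf_inst :: "('a, 'e) sf_inst \<Rightarrow> bool" where
  "wf_inst G \<longleftrightarrow> finite (V G) \<and> finite (Ed G)
     \<and> (\<forall>e\<in>Ed G. ends G e \<subseteq> V G \<and> card (ends G e) = 2)
     \<and> (\<forall>e\<in>Ed G. cost G e \<ge> 0)
     \<and> (\<forall>d\<in>dem G. d \<subseteq> V G \<and> card d = 2)"

definition conn :: "('a, 'e) sf_inst \<Rightarrow> 'e set \<Rightarrow> 'a \<Rightarrow> 'a \<Rightarrow> bool" where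
  "conn G F u v \<longleftrightarrow> (u, v) \<in> {(x, z). \<exists>e\<in>F. ends G e = {x, z}}\<^sup>*"

definition comps :: "('a, 'e) sf_inst \<Rightarrow> 'e set \<Rightarrow> 'a set set" where
  "comps G F = (\<lambda>u. {v \<in> V G. conn G F u v}) ` V G"

definition feasible :: "('a, 'e) sf_inst \<Rightarrow> 'e set \<Rightarrow> bool" where
  "feasible G F \<longleftrightarrow> F \<subseteq> Ed G \<and> (\<forall>d\<in>dem G. \<forall>u\<in>d. \<forall>v\<in>d. conn G F u v)"

definition cset :: "('a, 'e) sf_inst \<Rightarrow> 'e set \<Rightarrow> real" where
  "cset G F = (\<Sum>e\<in>F. cost G e)"

definition delta :: "('a, 'e) sf_inst \<Rightarrow> 'a set \<Rightarrow> 'e set" where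
  "delta G U = {e \<in> Ed G. card (ends G e \<inter> U) = 1}"

definition load :: "('a, 'e) sf_inst \<Rightarrow> ('a set \<Rightarrow> real \<Rightarrow> real) \<Rightarrow> 'e \<Rightarrow> real \<Rightarrow> real" where
  "load G y e t = (\<Sum>S | S \<subseteq> V G \<and> e \<in> delta G S. y S t)"

definition tight :: "('a, 'e) sf_inst \<Rightarrow> ('a set \<Rightarrow> real \<Rightarrow> real) \<Rightarrow> real \<Rightarrow> 'e set" where
  "tight G y t = {e \<in> Ed G. load G y e t = cost G e}"

definition comps_at :: "('a, 'e) sf_inst \<Rightarrow> ('a set \<Rightarrow> real \<Rightarrow> real) \<Rightarrow> real \<Rightarrow> 'a set set" where
  "comps_at G y t = comps G (tight G y t)"

definition demand_active :: "('a, 'e) sf_inst \<Rightarrow> 'e set \<Rightarrow> 'a set \<Rightarrow> bool" where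
  "demand_active G F C \<longleftrightarrow> (\<exists>v\<in>C. \<exists>w. {v, w} \<in> dem G \<and> \<not> conn G F v w)"

definition budget_active :: "('a, 'e) sf_inst \<Rightarrow> 'e set \<Rightarrow> ('a set \<Rightarrow> real \<Rightarrow> real) \<Rightarrow> real \<Rightarrow> 'a set \<Rightarrow> bool" where
  "budget_active G F b t C \<longleftrightarrow> \<not> demand_active G F C \<and> b C t > 0"

definition active :: "('a, 'e) sf_inst \<Rightarrow> ('a set \<Rightarrow> real \<Rightarrow> real) \<Rightarrow> ('a set \<Rightarrow> real \<Rightarrow> real) \<Rightarrow> real \<Rightarrow> 'a set set" where
  "active G y b t = {C \<in> comps_at G y t.
      demand_active G (tight G y t) C \<or> budget_active G (tight G y t) b t C}"

text \<open>(y, b) is a run of the eps-extended moat-growing algorithm: y S t is the dual of S at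
time t, b S t the budget of S at time t (meaningful while S is a component).  The dynamics are
given by right derivatives at every time t >= 0 (growth rates are determined by the current
state), continuity of the duals, the dual feasibility invariant (no edge is over-tight), the
tight edges being exactly those with load = cost, budgets starting at 0, and the budget of a
component at its creation being the sum of the budgets of the merged components (left limit).\<close>
definition moat_run :: "('a, 'e) sf_inst \<Rightarrow> real \<Rightarrow> ('a set \<Rightarrow> real \<Rightarrow> real) \<Rightarrow> ('a set \<Rightarrow> real \<Rightarrow> real) \<Rightarrow> bool" where
  "moat_run G eps y b \<longleftrightarrow>
     (\<forall>S. y S 0 = 0 \<and> continuous_on {0..} (y S)
        \<and> (\<forall>t\<ge>0. (y S has_real_derivative (if S \<in> active G y b t then 1 else 0)) (at t within {t..})))
   \<and> (\<forall>t\<ge>0. \<forall>e\<in>Ed G. load G y e t \<le> cost G e)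
   \<and> (\<forall>S\<in>comps_at G y 0. b S 0 = 0)
   \<and> (\<forall>t\<ge>0. \<forall>S\<in>comps_at G y t.
        (b S has_real_derivative
           (if demand_active G (tight G y t) S then eps
            else if budget_active G (tight G y t) b t S then -1 else 0)) (at t within {t..}))
   \<and> (\<forall>t>0. \<forall>S\<in>comps_at G y t.
        ((\<lambda>s. \<Sum>T\<in>{T \<in> comps_at G y s. T \<subseteq> S}. b T s) \<longlongrightarrow> b S t) (at_left t))"

definition yinf :: "('a set \<Rightarrow> real \<Rightarrow> real) \<Rightarrow> 'a set \<Rightarrow> real" where
  "yinf y S = Lim at_top (y S)"

definition deact :: "('a, 'e) sf_inst \<Rightarrow> ('a set \<Rightarrow> real \<Rightarrow> real) \<Rightarrow> ('a set \<Rightarrow> real \<Rightarrow> real) \<Rightarrow> 'a \<Rightarrow> ereal" where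
  "deact G y b v = (SUP t \<in> {t. 0 \<le> t \<and> (\<forall>s. 0 \<le> s \<and> s < t \<longrightarrow> (\<exists>C\<in>active G y b s. v \<in> C))}. ereal t)"

definition act_rel :: "('a, 'e) sf_inst \<Rightarrow> ('a set \<Rightarrow> real \<Rightarrow> real) \<Rightarrow> ('a set \<Rightarrow> real \<Rightarrow> real) \<Rightarrow> 'a \<Rightarrow> 'a \<Rightarrow> bool" where
  "act_rel G y b u v \<longleftrightarrow> (\<exists>t\<ge>0. (\<exists>C\<in>comps_at G y t. u \<in> C \<and> v \<in> C)
      \<and> ereal t \<le> deact G y b u \<and> ereal t \<le> deact G y b v)"

definition actively_connected :: "('a, 'e) sf_inst \<Rightarrow> ('a set \<Rightarrow> real \<Rightarrow> real) \<Rightarrow> ('a set \<Rightarrow> real \<Rightarrow> real) \<Rightarrow> 'a set \<Rightarrow> bool" where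
  "actively_connected G y b X \<longleftrightarrow> (\<forall>u\<in>X. \<forall>v\<in>X. act_rel G y b u v)"

definition merge_rel :: "'a set set \<Rightarrow> 'a set set \<Rightarrow> ('a set \<times> 'a set) set" where
  "merge_rel \<A> \<S> = {(A, B). A \<in> \<A> \<and> B \<in> \<A> \<and> (\<exists>S\<in>\<S>. S \<inter> A \<noteq> {} \<and> S \<inter> B \<noteq> {})}"

definition merged :: "'a set set \<Rightarrow> 'a set set \<Rightarrow> 'a set set set" where
  "merged \<A> \<S> = \<A> // (merge_rel \<A> \<S>)\<^sup>*"

definition gain :: "('a, 'e) sf_inst \<Rightarrow> ('a set \<Rightarrow> real \<Rightarrow> real) \<Rightarrow> ('a set \<Rightarrow> real \<Rightarrow> real) \<Rightarrow> 'a set set \<Rightarrow> real" where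
  "gain G y b \<S> = 2 * set_lebesgue_integral lborel {0..}
      (\<lambda>t. real (card (active G y b t)) - real (card (merged (active G y b t) \<S>)))"

definition conn_cost :: "('a, 'e) sf_inst \<Rightarrow> 'a set \<Rightarrow> real" where
  "conn_cost G X = Min (cset G ` {F. F \<subseteq> Ed G \<and> (\<forall>u\<in>X. \<forall>v\<in>X. conn G F u v)})"

definition cost_coll :: "('a, 'e) sf_inst \<Rightarrow> 'a set set \<Rightarrow> real" where
  "cost_coll G \<S> = (\<Sum>S\<in>\<S>. conn_cost G S)"

definition sep :: "('a, 'e) sf_inst \<Rightarrow> 'a set \<Rightarrow> 'a set set" where
  "sep G U = {d \<in> dem G. d \<inter> U \<noteq> {} \<and> d - U \<noteq> {}}"

definition supp :: "('a, 'e) sf_inst \<Rightarrow> ('a set \<Rightarrow> real \<Rightarrow> real) \<Rightarrow> 'a set set" where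
  "supp G y = {U. U \<subseteq> V G \<and> yinf y U \<noteq> 0}"

definition Usep :: "('a, 'e) sf_inst \<Rightarrow> ('a set \<Rightarrow> real \<Rightarrow> real) \<Rightarrow> 'a set set" where
  "Usep G y = {U \<in> supp G y. sep G U \<noteq> {}}"

definition ysum :: "('a set \<Rightarrow> real \<Rightarrow> real) \<Rightarrow> 'a set set \<Rightarrow> real" where
  "ysum y \<U> = (\<Sum>U\<in>\<U>. yinf y U)"

definition excess :: "('a, 'e) sf_inst \<Rightarrow> ('a set \<Rightarrow> real \<Rightarrow> real) \<Rightarrow> 'e set \<Rightarrow> real" where
  "excess G y F = cset G F - ysum y (Usep G y)"

definition coactive :: "('a, 'e) sf_inst \<Rightarrow> ('a set \<Rightarrow> real \<Rightarrow> real) \<Rightarrow> ('a set \<Rightarrow> real \<Rightarrow> real) \<Rightarrow> 'a set set \<Rightarrow> bool" where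
  "coactive G y b \<X> \<longleftrightarrow> (\<exists>t\<ge>0. \<X> \<subseteq> active G y b t)"

definition autarkic_pair :: "('a, 'e) sf_inst \<Rightarrow> ('a set \<Rightarrow> real \<Rightarrow> real) \<Rightarrow> ('a set \<Rightarrow> real \<Rightarrow> real) \<Rightarrow> 'a set set \<Rightarrow> bool" where
  "autarkic_pair G y b P \<longleftrightarrow> (\<exists>A B. P = {A, B} \<and> A \<in> supp G y \<and> B \<in> supp G y \<and> A \<inter> B = {}
      \<and> coactive G y b {A, B} \<and> sep G A = sep G B \<and> sep G A \<noteq> {})"

definition autarkic_triple :: "('a, 'e) sf_inst \<Rightarrow> ('a set \<Rightarrow> real \<Rightarrow> real) \<Rightarrow> ('a set \<Rightarrow> real \<Rightarrow> real) \<Rightarrow> 'a set set \<Rightarrow> bool" where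
  "autarkic_triple G y b P \<longleftrightarrow> (\<exists>A1 A2 A3. P = {A1, A2, A3}
      \<and> A1 \<inter> A2 = {} \<and> A1 \<inter> A3 = {} \<and> A2 \<inter> A3 = {}
      \<and> coactive G y b {A1, A2, A3}
      \<and> sep G A1 \<noteq> {} \<and> sep G A2 \<noteq> {} \<and> sep G A3 \<noteq> {}
      \<and> sep G (A1 \<union> A2 \<union> A3) = {})"

text \<open>sep of a pair (= sep A = sep B) or triple (union of the seps)\<close>
definition psep :: "('a, 'e) sf_inst \<Rightarrow> 'a set set \<Rightarrow> 'a set set" where
  "psep G P = (\<Union>A\<in>P. sep G A)"

definition crossing_free_autarkic :: "('a, 'e) sf_inst \<Rightarrow> ('a set \<Rightarrow> real \<Rightarrow> real) \<Rightarrow> ('a set \<Rightarrow> real \<Rightarrow> real) \<Rightarrow> 'a set set set \<Rightarrow> bool" where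
  "crossing_free_autarkic G y b \<P> \<longleftrightarrow>
     (\<forall>P\<in>\<P>. autarkic_pair G y b P \<or> autarkic_triple G y b P)
   \<and> (\<forall>P\<in>\<P>. \<forall>Q\<in>\<P>. P \<noteq> Q \<longrightarrow> psep G P \<inter> psep G Q = {})"

definition coverage :: "('a, 'e) sf_inst \<Rightarrow> ('a set \<Rightarrow> real \<Rightarrow> real) \<Rightarrow> 'a set set set \<Rightarrow> real" where
  "coverage G y \<P> = ysum y {U \<in> supp G y. \<exists>P\<in>\<P>. \<exists>A\<in>P. sep G A = sep G U}"

text \<open>Representative vertices of the connector of P, given the designation rep, which assigns
to an (unordered) pair {A,B} of member sets with intersecting seps a demand pair in
sep(A) \<inter> sep(B).  For an autarkic pair this is the single representative demand pair.\<close>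
definition terminals :: "('a, 'e) sf_inst \<Rightarrow> ('a set set \<Rightarrow> 'a set) \<Rightarrow> 'a set set \<Rightarrow> 'a set" where
  "terminals G rep P = \<Union>{rep {A, B} | A B. A \<in> P \<and> B \<in> P \<and> A \<noteq> B \<and> sep G A \<inter> sep G B \<noteq> {}}"

text \<open>cost of the connector: minimum Steiner tree on the terminals (for a pair: shortest a-b path)\<close>
definition connector_cost :: "('a, 'e) sf_inst \<Rightarrow> ('a set set \<Rightarrow> 'a set) \<Rightarrow> 'a set set set \<Rightarrow> real" where
  "connector_cost G rep \<P> = (\<Sum>P\<in>\<P>. conn_cost G (terminals G rep P))"

end

theory Submission
  imports Defs
begin

text \<open>
Optimality and minimality make OPT a forest all of whose edges are essential. A moat with exactly
one OPT edge is a leaf of one tree of OPT; every further OPT edge at a moat, and every OPT edge at a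
budget-active moat, is paid for by the excess.

The core of a tree consists of its vertices that stay active until the whole tree lies in one
component. The cores form the collection of actively connected sets. A leaf moat that misses the
core of its tree never grows, along active moats, into a moat without OPT edges, so the budget it
generates is consumed by budget-active moats with at least two OPT edges: this gives the term
1/(2 eps) times the excess. If n moats meet the core and k of them are leaves, then merging the core
gains 2 (n - 1) per unit of time while the core pays for k, which is enough except when n = k = 2. In
that case the two leaves form an autarkic pair, and their common separated demands do not change over
time.
\<close>

section \<open>Connectivity and minimal forests\<close>

text \<open>The surplus \<open>2 * (n - 1) - k\<close> of merging a core vanishes only for
  \<open>n = k = 2\<close>. An autarkic pair repairs such a phase, but it is chosen once per tree,
  while its connector is loaded in all phases. The connector joins two vertices, so at most two
  leaves cross it at a time. For \<open>n = k >= 4\<close>, or when some moat at the core is not a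
  leaf, the surplus covers this; for \<open>n = k = 3\<close> one moat must still count as covered.
  This is why separated demands of a leaf are expressed by its trace on the core, and why one trace
  of the pair is shown to persist in phases with up to three moats. The core looks at the whole
  history of a vertex up to the moment its tree lies in one component. This gives one set per tree,
  the same in all phases and closed under demand partners. Lost leaves cannot be charged within
  their own phase, since the budget they create may be consumed much later; they need one global
  balance. Each consumer has two OPT edges, which is the 2 in \<open>2 * eps\<close>.\<close>

lemma conn_refl [simp]: "conn G F u u"
  by (simp add: conn_def)

lemma conn_trans: "conn G F u v \<Longrightarrow> conn G F v w \<Longrightarrow> conn G F u w"
  by (auto simp: conn_def)

lemma conn_sym: "conn G F u v \<Longrightarrow> conn G F v u"
  unfolding conn_def
  by (rule symD[OF sym_rtrancl]) (auto simp: sym_def insert_commute)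

lemma conn_mono: "conn G F u v \<Longrightarrow> F \<subseteq> F' \<Longrightarrow> conn G F' u v"
  unfolding conn_def
  by (erule rtrancl_mono[THEN subsetD, rotated]) auto

lemma conn_edge: "e \<in> F \<Longrightarrow> ends G e = {x, z} \<Longrightarrow> conn G F x z"
  unfolding conn_def by auto

lemma conn_induct [consumes 1, case_names base step]:
  assumes "conn G F u v" "P u"
    "\<And>x z e. conn G F u x \<Longrightarrow> e \<in> F \<Longrightarrow> ends G e = {x, z} \<Longrightarrow> P x \<Longrightarrow> P z"
  shows "P v"
  using assms(1) unfolding conn_def
  by (induction rule: rtrancl_induct) (use assms(2,3) in \<open>auto simp: conn_def\<close>)

lemma wf_ends: "wf_inst G \<Longrightarrow> e \<in> Ed G \<Longrightarrow> ends G e \<subseteq> V G \<and> card (ends G e) = 2"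
  and wf_dem: "wf_inst G \<Longrightarrow> d \<in> dem G \<Longrightarrow> d \<subseteq> V G \<and> card d = 2"
  by (simp_all add: wf_inst_def)

text \<open>The walk may cross \<open>e\<close> several times, but each further crossing only
  returns to one of the two ends of \<open>e\<close>, so a single crossing can be kept.\<close>

lemma conn_split_edge:
  assumes "conn G F u v" "\<not> conn G (F - {e}) u v"
  shows "\<exists>x z. ends G e = {x, z} \<and> conn G (F - {e}) u x \<and> conn G (F - {e}) z v"
proof -
  have "conn G (F - {e}) u v \<or> (\<exists>x z. ends G e = {x, z} \<and> conn G (F - {e}) u x \<and> conn G (F - {e}) z v)"
    using assms(1)
  proof (induction rule: conn_induct)
    case (step x z f)
    show ?case
    proof (cases "f = e")
      case False
      then have "conn G (F - {e}) x z" using step conn_edge[of f "F - {e}" G x z] by auto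
      then show ?thesis using step.IH conn_trans[of G "F - {e}" _ x z] by blast
    next
      case True
      from step.IH show ?thesis
      proof
        assume "conn G (F - {e}) u x"
        then have "ends G e = {x, z} \<and> conn G (F - {e}) u x \<and> conn G (F - {e}) z z"
          using step(3) True by simp
        then show ?thesis by blast
      next
        assume "\<exists>x' z'. ends G e = {x', z'} \<and> conn G (F - {e}) u x' \<and> conn G (F - {e}) z' x"
        then obtain x' z' where *: "ends G e = {x', z'}" "conn G (F - {e}) u x'" by blast
        then have "z = x' \<or> z = z'" using step(3) True by (auto simp: doubleton_eq_iff)
        moreover have "ends G e = {x', z'} \<and> conn G (F - {e}) u x' \<and> conn G (F - {e}) z' z'"
          using * by simp
        ultimately show ?thesis using *(2) by blast
      qed
    qed
  qed simp
  then show ?thesis using assms(2) by blast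
qed

lemma comps_sub: "U \<in> comps G F \<Longrightarrow> U \<subseteq> V G"
  by (auto simp: comps_def)

lemma comps_finite: "wf_inst G \<Longrightarrow> finite (comps G F)"
  by (simp add: comps_def wf_inst_def)

lemma comps_nonempty: "U \<in> comps G F \<Longrightarrow> U \<noteq> {}"
  by (auto simp: comps_def)

lemma comps_member_iff:
  assumes "U \<in> comps G F" "u \<in> U"
  shows "v \<in> U \<longleftrightarrow> v \<in> V G \<and> conn G F u v"
  using assms by (auto simp: comps_def dest: conn_sym intro: conn_trans)

lemma comps_eq: "U \<in> comps G F \<Longrightarrow> U' \<in> comps G F \<Longrightarrow> x \<in> U \<Longrightarrow> x \<in> U' \<Longrightarrow> U = U'"
  by (metis comps_member_iff subsetI subset_antisym)

lemma comps_cover: "v \<in> V G \<Longrightarrow> \<exists>U\<in>comps G F. v \<in> U"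
  unfolding comps_def by (metis (mono_tags, lifting) conn_refl imageI mem_Collect_eq)

lemma comps_refine:
  assumes "F \<subseteq> F'" "U \<in> comps G F"
  shows "\<exists>U'\<in>comps G F'. U \<subseteq> U'"
proof -
  obtain u where u: "u \<in> V G" "U = {v \<in> V G. conn G F u v}" using assms(2) by (auto simp: comps_def)
  have "{v \<in> V G. conn G F u v} \<subseteq> {v \<in> V G. conn G F' u v}" using assms(1) by (auto intro: conn_mono)
  then show ?thesis using u by (auto simp: comps_def)
qed

lemma comps_refine_sub:
  assumes "F \<subseteq> F'" "U \<in> comps G F" "U' \<in> comps G F'" "x \<in> U" "x \<in> U'"
  shows "U \<subseteq> U'"
  using comps_refine[OF assms(1,2)] comps_eq[OF _ assms(3)] assms(4,5) by blast

text \<open>A partner is disconnected from a vertex of the component exactly when it lies outside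
  the component. Activity by demand can therefore be read off \<open>sep\<close>, without looking at
  the tight edges.\<close>

lemma demand_active_iff:
  assumes "wf_inst G" "F \<subseteq> Ed G" "C \<in> comps G F"
  shows "demand_active G F C \<longleftrightarrow> sep G C \<noteq> {}"
proof
  assume "demand_active G F C"
  then obtain v w where vw: "v \<in> C" "{v, w} \<in> dem G" "\<not> conn G F v w"
    by (auto simp: demand_active_def)
  then have "w \<notin> C" using comps_member_iff[OF assms(3)] by auto
  then show "sep G C \<noteq> {}" using vw by (auto simp: sep_def)
next
  assume "sep G C \<noteq> {}"
  then obtain d where d: "d \<in> dem G" "d \<inter> C \<noteq> {}" "d - C \<noteq> {}" by (auto simp: sep_def)
  then obtain v w where vw: "v \<in> d" "v \<in> C" "w \<in> d" "w \<notin> C" by auto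
  have "card d = 2" "d \<subseteq> V G" using d wf_dem[OF assms(1)] by auto
  then have "d = {v, w}" using vw by (auto simp: card_2_iff)
  moreover have "\<not> conn G F v w"
    using comps_member_iff[OF assms(3) vw(2)] vw \<open>d \<subseteq> V G\<close> by auto
  ultimately show "demand_active G F C" using d vw by (auto simp: demand_active_def)
qed

lemma sep_dem:
  assumes "wf_inst G" "d \<in> sep G U"
  obtains a b where "d = {a, b}" "a \<in> U" "b \<notin> U" "d \<in> dem G" "a \<in> V G" "b \<in> V G"
proof -
  have d: "d \<in> dem G" "d \<inter> U \<noteq> {}" "d - U \<noteq> {}" using assms(2) by (auto simp: sep_def)
  then obtain v w where vw: "v \<in> d" "v \<in> U" "w \<in> d" "w \<notin> U" by auto
  have "card d = 2" "d \<subseteq> V G" using d wf_dem[OF assms(1)] by auto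
  then have "d = {v, w}" using vw by (auto simp: card_2_iff)
  then show ?thesis using that[of v w] vw d \<open>d \<subseteq> V G\<close> by blast
qed

lemma delta_iff:
  assumes "ends G e = {x, z}" "x \<noteq> z"
  shows "e \<in> delta G U \<longleftrightarrow> e \<in> Ed G \<and> (x \<in> U \<longleftrightarrow> z \<notin> U)"
  using assms by (cases "x \<in> U"; cases "z \<in> U") (auto simp: delta_def Int_insert_left)

lemma conn_not_crossing:
  assumes "wf_inst G" "F \<subseteq> Ed G" "delta G U \<inter> F = {}" "conn G F u v"
  shows "u \<in> U \<longleftrightarrow> v \<in> U"
  using assms(4)
proof (induction rule: conn_induct)
  case (step x z e)
  have "card (ends G e) = 2" using wf_ends[OF assms(1), of e] assms(2) step(2) by auto
  then have "x \<noteq> z" using step(3) by auto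
  moreover have "e \<notin> delta G U" "e \<in> Ed G" using assms(2,3) step(2) by auto
  ultimately have "x \<in> U \<longleftrightarrow> z \<in> U" using delta_iff[OF step(3)] by blast
  then show ?case using step(4) by simp
qed simp

section \<open>OPT as a forest of essential edges\<close>

locale minimal_forest =
  fixes G :: "('a, 'e) sf_inst" and OPT :: "'e set"
  assumes wf: "wf_inst G" and feas: "feasible G OPT"
    and essential: "e \<in> OPT \<Longrightarrow> \<not> feasible G (OPT - {e})"
begin

abbreviation trees :: "'a set set" where
  "trees \<equiv> comps G OPT"

definition deg :: "'a set \<Rightarrow> nat" where
  "deg U = card (delta G U \<inter> OPT)"

text \<open>Stated for arbitrary \<open>W\<close>, because it is applied both to trees and to the
  terminal sets whose connection cost is estimated.\<close>

definition cuts :: "'a set \<Rightarrow> 'a set \<Rightarrow> bool" where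
  "cuts U W \<longleftrightarrow> U \<inter> W \<noteq> {} \<and> W - U \<noteq> {}"

text \<open>In a forest these are the edges of the smallest subtree spanning \<open>X\<close>;
  testing by deletion avoids a formal notion of path.\<close>

definition span_edges :: "'a set \<Rightarrow> 'e set" where
  "span_edges X = {e \<in> OPT. \<exists>u\<in>X. \<exists>v\<in>X. \<not> conn G (OPT - {e}) u v}"

lemma OPT_sub: "OPT \<subseteq> Ed G" and OPT_finite: "finite OPT"
  using feas wf by (auto simp: feasible_def wf_inst_def intro: finite_subset)

lemma fin_delta: "finite (delta G U \<inter> OPT)"
  using OPT_finite by simp

lemma ends_ne:
  assumes "e \<in> Ed G" "ends G e = {x, z}"
  shows "x \<noteq> z"
proof -
  have "card (ends G e) = 2" using assms(1) wf by (simp add: wf_inst_def)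
  then show ?thesis using assms(2) by auto
qed

text \<open>If the ends of \<open>e\<close> stayed connected without it, every walk through
  \<open>e\<close> could be rerouted and \<open>OPT - {e}\<close> would still be feasible.\<close>

lemma bridge:
  assumes "e \<in> OPT" "ends G e = {x, z}"
  shows "\<not> conn G (OPT - {e}) x z"
proof
  assume xz: "conn G (OPT - {e}) x z"
  have "conn G (OPT - {e}) u v" if uv: "conn G OPT u v" for u v
  proof (rule ccontr)
    assume "\<not> conn G (OPT - {e}) u v"
    then obtain x' z' where *: "ends G e = {x', z'}" "conn G (OPT - {e}) u x'" "conn G (OPT - {e}) z' v"
      using conn_split_edge[OF uv] by blast
    then have "conn G (OPT - {e}) x' z'"
      using xz conn_sym[OF xz] assms(2) by (auto simp: doubleton_eq_iff)
    then have "conn G (OPT - {e}) u v" using conn_trans[OF *(2)] conn_trans[OF _ *(3)] by blast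
    then show False using \<open>\<not> conn G (OPT - {e}) u v\<close> by blast
  qed
  then have "feasible G (OPT - {e})" using feas by (auto simp: feasible_def)
  then show False using essential assms by blast
qed

text \<open>In a forest, a minimal connecting edge set consists of bridges.\<close>

lemma conn_span:
  assumes "conn G OPT u v"
  shows "conn G {e \<in> OPT. \<not> conn G (OPT - {e}) u v} u v"
proof -
  define Q where "Q F \<longleftrightarrow> F \<subseteq> OPT \<and> conn G F u v" for F
  have "Q OPT" using assms by (simp add: Q_def)
  then obtain F where F: "Q F" "\<And>F'. Q F' \<Longrightarrow> card F \<le> card F'"
    using ex_has_least_nat[of Q OPT card] by blast
  have fin: "finite F" using F(1) OPT_finite by (auto simp: Q_def intro: finite_subset)
  have "\<not> conn G (OPT - {e}) u v" if e: "e \<in> F" for e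
  proof
    assume uv: "conn G (OPT - {e}) u v"
    have "\<not> Q (F - {e})" using F(2)[of "F - {e}"] card_Diff1_less[OF fin e] by auto
    then have "\<not> conn G (F - {e}) u v" using F(1) by (auto simp: Q_def)
    then obtain x z where xz: "ends G e = {x, z}" "conn G (F - {e}) u x" "conn G (F - {e}) z v"
      using conn_split_edge[of G F u v e] F(1) unfolding Q_def by blast
    have sub: "F - {e} \<subseteq> OPT - {e}" using F(1) by (auto simp: Q_def)
    \<comment> \<open>From \<open>x\<close> back to \<open>u\<close>, across to \<open>v\<close> by
      the walk that avoids \<open>e\<close>, and back to \<open>z\<close>: a detour around
      \<open>e\<close>.\<close>
    have "conn G (OPT - {e}) x z"
      using conn_trans[OF conn_sym[OF conn_mono[OF xz(2) sub]]
          conn_trans[OF uv conn_sym[OF conn_mono[OF xz(3) sub]]]] .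
    then show False using bridge xz(1) e F(1) by (auto simp: Q_def)
  qed
  then show ?thesis using F(1) by (auto simp: Q_def intro: conn_mono)
qed

lemma tree_conn: "W \<in> trees \<Longrightarrow> u \<in> W \<Longrightarrow> v \<in> W \<Longrightarrow> conn G OPT u v"
  using comps_member_iff by fast

lemma conn_cost_le_span:
  assumes "W \<in> trees" "X \<subseteq> W"
  shows "conn_cost G X \<le> cset G (span_edges X)"
proof -
  have "conn G (span_edges X) u v" if "u \<in> X" "v \<in> X" for u v
    using conn_span[OF tree_conn[OF assms(1), of u v]] that assms(2)
    by (rule_tac conn_mono) (auto simp: span_edges_def)
  moreover have "span_edges X \<subseteq> Ed G" using OPT_sub by (auto simp: span_edges_def)
  moreover have "finite {F. F \<subseteq> Ed G \<and> (\<forall>u\<in>X. \<forall>v\<in>X. conn G F u v)}"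
    using wf by (simp add: wf_inst_def)
  ultimately show ?thesis unfolding conn_cost_def by (intro Min_le) auto
qed

lemma span_edges_in_tree:
  assumes "W \<in> trees" "X \<subseteq> W" "e \<in> span_edges X"
  shows "ends G e \<subseteq> W"
proof -
  obtain u v where uv: "u \<in> X" "v \<in> X" "\<not> conn G (OPT - {e}) u v" "e \<in> OPT"
    using assms(3) by (auto simp: span_edges_def)
  obtain x z where xz: "ends G e = {x, z}" "conn G (OPT - {e}) u x" "conn G (OPT - {e}) z v"
    using conn_split_edge[OF tree_conn[OF assms(1), of u v] uv(3)] uv assms(2) by auto
  have "{x, z} \<subseteq> V G" using xz(1) wf_ends[OF wf, of e] uv(4) OPT_sub by auto
  moreover have "conn G OPT u x" "conn G OPT v z"
    using conn_mono[OF xz(2)] conn_mono[OF conn_sym[OF xz(3)]] by auto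
  ultimately show ?thesis
    using comps_member_iff[OF assms(1), of u x] comps_member_iff[OF assms(1), of v z] uv assms(2) xz by auto
qed

text \<open>The edges whose deletion separates \<open>u\<close> from \<open>v\<close> already
  connect the two, so one of them crosses \<open>U\<close>, and such edges cannot leave the
  tree.\<close>

lemma cut_edge:
  assumes "W \<in> trees" "cuts U W"
  shows "\<exists>e\<in>delta G U \<inter> OPT. ends G e \<subseteq> W"
proof -
  obtain u v where uv: "u \<in> U" "u \<in> W" "v \<in> W" "v \<notin> U" using assms(2) by (auto simp: cuts_def)
  have "conn G {e \<in> OPT. \<not> conn G (OPT - {e}) u v} u v"
    using conn_span[OF tree_conn[OF assms(1)]] uv by blast
  then have "delta G U \<inter> {e \<in> OPT. \<not> conn G (OPT - {e}) u v} \<noteq> {}"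
    using conn_not_crossing[OF wf, of "{e \<in> OPT. \<not> conn G (OPT - {e}) u v}" U u v] uv OPT_sub by auto
  then obtain e where e: "e \<in> delta G U" "e \<in> OPT" "\<not> conn G (OPT - {e}) u v" by auto
  then have "ends G e \<subseteq> W"
    using span_edges_in_tree[OF assms(1), of "{u, v}" e] uv by (auto simp: span_edges_def)
  then show ?thesis using e by auto
qed

lemma tree_disjoint: "W \<in> trees \<Longrightarrow> W' \<in> trees \<Longrightarrow> x \<in> W \<Longrightarrow> x \<in> W' \<Longrightarrow> W = W'"
  by (rule comps_eq)

lemma ends_nonempty: "e \<in> OPT \<Longrightarrow> ends G e \<noteq> {}"
  using wf_ends[OF wf, of e] OPT_sub by auto

lemma edge_tree_unique:
  assumes "W \<in> trees" "W' \<in> trees" "e \<in> OPT" "ends G e \<subseteq> W" "ends G e \<subseteq> W'"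
  shows "W = W'"
  using ends_nonempty[OF assms(3)] assms tree_disjoint by blast

text \<open>Each tree that is cut owns a crossing edge, and an edge lies in one tree only. This
  limits how many trees can share a moat.\<close>

lemma card_cut_trees:
  "card {W \<in> trees. cuts U W} \<le> deg U"
proof -
  define f where "f W = (SOME e. e \<in> delta G U \<inter> OPT \<and> ends G e \<subseteq> W)" for W
  have f: "f W \<in> delta G U \<inter> OPT \<and> ends G (f W) \<subseteq> W" if "W \<in> {W \<in> trees. cuts U W}" for W
    unfolding f_def by (rule someI_ex) (use cut_edge that in blast)
  have "inj_on f {W \<in> trees. cuts U W}"
  proof (rule inj_onI)
    fix W W' assume *: "W \<in> {W \<in> trees. cuts U W}" "W' \<in> {W \<in> trees. cuts U W}" "f W = f W'"
    then show "W = W'" using f[of W] f[of W'] edge_tree_unique[of W W' "f W"] by auto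
  qed
  then show ?thesis unfolding deg_def
    using f by (intro card_inj_on_le[of f] fin_delta) auto
qed

lemma deg1_cut_unique:
  assumes "deg U = 1" "W \<in> trees" "W' \<in> trees" "cuts U W" "cuts U W'"
  shows "W = W'"
proof -
  obtain e where "delta G U \<inter> OPT = {e}" using assms(1) by (auto simp: deg_def card_1_singleton_iff)
  then show ?thesis
    using cut_edge[OF assms(2,4)] cut_edge[OF assms(3,5)] edge_tree_unique[OF assms(2,3), of e] by auto
qed

lemma dem_in_tree:
  assumes "d \<in> dem G"
  shows "\<exists>W\<in>trees. d \<subseteq> W"
proof -
  have d: "card d = 2" "d \<subseteq> V G" using wf_dem[OF wf assms] by auto
  then obtain a where a: "a \<in> d" by fastforce
  then obtain W where W: "W \<in> trees" "a \<in> W" using comps_cover[of a G OPT] d by blast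
  have "b \<in> W" if "b \<in> d" for b
    using comps_member_iff[OF W, of b] d(2) feas assms a that by (auto simp: feasible_def)
  then show ?thesis using W(1) by blast
qed

lemma sep_cuts:
  assumes "d \<in> sep G U"
  shows "\<exists>W\<in>trees. d \<subseteq> W \<and> cuts U W"
proof -
  obtain a b where ab: "d = {a, b}" "a \<in> U" "b \<notin> U" "d \<in> dem G" using sep_dem[OF wf assms] by blast
  moreover obtain W where "W \<in> trees" "d \<subseteq> W" using dem_in_tree[OF ab(4)] by blast
  ultimately show ?thesis unfolding cuts_def by blast
qed

lemma deg_pos_of_cuts: "W \<in> trees \<Longrightarrow> cuts U W \<Longrightarrow> deg U \<ge> 1"
  using cut_edge[of W U] fin_delta[of U] unfolding deg_def
  by (auto simp: Suc_le_eq card_gt_0_iff)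

lemma deg_pos_of_sep: "sep G U \<noteq> {} \<Longrightarrow> deg U \<ge> 1"
  using sep_cuts deg_pos_of_cuts by blast

text \<open>Once the single OPT edge at \<open>U\<close> is deleted, connectivity respects the cut
  \<open>U\<close>, while the ends of that edge lie on opposite sides of it.\<close>

lemma deg1_separates:
  assumes "delta G U \<inter> OPT = {e}" "conn G OPT u v" "\<not> conn G (OPT - {e}) u v"
  shows "u \<in> U \<longleftrightarrow> v \<notin> U"
proof -
  obtain x z where xz: "ends G e = {x, z}" "conn G (OPT - {e}) u x" "conn G (OPT - {e}) z v"
    using conn_split_edge[OF assms(2,3)] by auto
  have e: "e \<in> delta G U" "e \<in> Ed G" using assms(1) OPT_sub by auto
  have *: "OPT - {e} \<subseteq> Ed G" "delta G U \<inter> (OPT - {e}) = {}" using assms(1) OPT_sub by auto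
  have "u \<in> U \<longleftrightarrow> x \<in> U" "z \<in> U \<longleftrightarrow> v \<in> U"
    using conn_not_crossing[OF wf *] xz by auto
  then show ?thesis using delta_iff[OF xz(1) ends_ne[OF e(2) xz(1)]] e by auto
qed

text \<open>Deleting the edge at a leaf moat breaks some demand pair, and
  \<open>deg1_separates\<close> puts its partners on opposite sides of \<open>U\<close>. Hence a
  budget-active moat never has exactly one OPT edge.\<close>

lemma sep_of_deg1:
  assumes "deg U = 1"
  shows "sep G U \<noteq> {}"
proof -
  obtain e where e: "delta G U \<inter> OPT = {e}" using assms by (auto simp: deg_def card_1_singleton_iff)
  then have "\<not> feasible G (OPT - {e})" using essential by auto
  then obtain d u v where d: "d \<in> dem G" "u \<in> d" "v \<in> d" "\<not> conn G (OPT - {e}) u v"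
    using OPT_sub by (auto simp: feasible_def)
  then have "conn G OPT u v" using feas by (auto simp: feasible_def)
  then show ?thesis using deg1_separates[OF e _ d(4)] d by (auto simp: sep_def)
qed

end

section \<open>Moat growing in finitely many phases\<close>

text \<open>Here \<open>n\<close> moats meet a core, \<open>k\<close> of them leaves, \<open>p\<close> of those are crossed by the connector of the
autarkic pair and \<open>cov\<close> are covered by it; without a pair, \<open>p = cov = 0\<close>.\<close>

lemma leaf_count_inequality:
  fixes k n p cov :: nat
  assumes "2 \<le> n" "k \<le> n" "p \<le> 2" "p \<le> k"
    and "n = k \<Longrightarrow> k = 2 \<Longrightarrow> 2 \<le> cov" and "n = k \<Longrightarrow> k = 3 \<Longrightarrow> p = 0 \<or> 1 \<le> cov"
  shows "real k \<le> 10 / 3 * (2 * (real n - 1) - real k) + (2 * real cov - real p)"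
proof (cases "n = k")
  case True
  consider "k = 2" | "k = 3" | "4 \<le> k" using assms(1) True by linarith
  then show ?thesis
  proof cases
    \<comment> \<open>The critical case: merging yields nothing, and \<open>2 * cov - p\<close> is
      at least 4 - 2, exactly the two moats to be paid for.\<close>
    case 1
    then have "2 \<le> real cov" using assms(5) True by simp
    then show ?thesis using 1 True assms(3) by simp
  next
    \<comment> \<open>Merging yields 10/3, which suffices for three moats once the connector,
      crossed at most twice, is compensated by one covered moat.\<close>
    case 2
    then have "p = 0 \<or> 1 \<le> real cov" using assms(6) True by force
    then show ?thesis using 2 True assms(3) by auto
  next
    case 3
    then show ?thesis using True assms(3) by (simp add: field_simps)
  qed
next
  case False
  \<comment> \<open>One moat that is not a leaf raises the merging surplus to at least
    \<open>k\<close>.\<close>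
  then have "k + 1 \<le> n" using assms(2) by simp
  then have "real n \<ge> real k + 1" by linarith
  then show ?thesis using assms(3,4) by (simp add: field_simps)
qed

text \<open>The continuous process is reduced to finitely many intervals: phase \<open>i < N\<close>
  lasts \<open>len i\<close>, \<open>bud i\<close> holds the budgets at its start, and the state
  with index \<open>N\<close> is terminal.\<close>

locale moat_phases = minimal_forest G OPT for G :: "('a, 'e) sf_inst" and OPT +
  fixes Fs :: "nat \<Rightarrow> 'e set" and A :: "nat \<Rightarrow> 'a set set" and len :: "nat \<Rightarrow> real"
    and bud :: "nat \<Rightarrow> 'a set \<Rightarrow> real" and N :: nat and eps :: real
  assumes Fs_sub: "Fs i \<subseteq> Ed G"
    and Fs_mono: "i \<le> j \<Longrightarrow> j \<le> N \<Longrightarrow> Fs i \<subseteq> Fs j"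
    and A_sub: "i \<le> N \<Longrightarrow> A i \<subseteq> comps G (Fs i)"
    and A_sep: "i \<le> N \<Longrightarrow> U \<in> comps G (Fs i) \<Longrightarrow> sep G U \<noteq> {} \<Longrightarrow> U \<in> A i"
    and A_last: "A N = {}"
    and len_pos: "i < N \<Longrightarrow> len i > 0"
    and eps_pos: "eps > 0"
    and bud_nonneg: "i \<le> N \<Longrightarrow> U \<in> comps G (Fs i) \<Longrightarrow> bud i U \<ge> 0"
    and bud_active: "i \<le> N \<Longrightarrow> U \<in> comps G (Fs i) \<Longrightarrow> bud i U > 0 \<Longrightarrow> U \<in> A i"
    and bud_end_nonneg: "i < N \<Longrightarrow> U \<in> comps G (Fs i) \<Longrightarrow>
      bud i U + len i * (if sep G U \<noteq> {} then eps else if U \<in> A i then -1 else 0) \<ge> 0"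
    and bud_step: "i < N \<Longrightarrow> U' \<in> comps G (Fs (Suc i)) \<Longrightarrow>
      bud (Suc i) U' = (\<Sum>U\<in>{U \<in> comps G (Fs i). U \<subseteq> U'}.
        bud i U + len i * (if sep G U \<noteq> {} then eps else if U \<in> A i then -1 else 0))"
    and load_le: "e \<in> Ed G \<Longrightarrow> (\<Sum>i<N. len i * card {U \<in> A i. e \<in> delta G U}) \<le> cost G e"
begin

section \<open>Cores of trees and the moats that meet them\<close>

definition whole :: "nat \<Rightarrow> 'a set \<Rightarrow> bool" where
  "whole i W \<longleftrightarrow> (\<exists>U\<in>comps G (Fs i). W \<subseteq> U)"

definition awake :: "nat \<Rightarrow> 'a \<Rightarrow> bool" where
  "awake i v \<longleftrightarrow> (\<exists>U\<in>A i. v \<in> U)"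

text \<open>A tree may never lie in one component, for instance because a Steiner vertex of OPT is
  never reached. Its core is then empty and all its leaf moats are lost.\<close>

definition core :: "'a set \<Rightarrow> 'a set" where
  "core W = (if \<exists>m\<le>N. whole m W then {v \<in> W. \<forall>j\<le>N. \<not> whole j W \<longrightarrow> awake j v} else {})"

definition hit :: "nat \<Rightarrow> 'a set \<Rightarrow> 'a set set" where
  "hit i W = {U \<in> A i. U \<inter> core W \<noteq> {}}"

definition leaves :: "nat \<Rightarrow> 'a set \<Rightarrow> 'a set set" where
  "leaves i W = {U \<in> A i. deg U = 1 \<and> cuts U W \<and> U \<inter> core W \<noteq> {}}"

text \<open>A moat with one OPT edge cuts exactly one tree, so the quantifier speaks about that
  tree.\<close>

definition lost :: "nat \<Rightarrow> 'a set set" where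
  "lost i = {U \<in> A i. deg U = 1 \<and> (\<forall>W\<in>trees. cuts U W \<longrightarrow> U \<inter> core W = {})}"

lemma core_sub: "core W \<subseteq> W"
  by (auto simp: core_def)

lemma A_finite: "i \<le> N \<Longrightarrow> finite (A i)"
  using A_sub comps_finite[OF wf] finite_subset by blast

lemma trees_finite: "finite trees"
  by (rule comps_finite[OF wf])

lemma hit_finite: "i \<le> N \<Longrightarrow> finite (hit i W)"
  unfolding hit_def using A_finite by simp

lemma A_eq: "i \<le> N \<Longrightarrow> U \<in> A i \<Longrightarrow> U' \<in> A i \<Longrightarrow> x \<in> U \<Longrightarrow> x \<in> U' \<Longrightarrow> U = U'"
  using comps_eq[of U G "Fs i" U' x] A_sub[of i] by auto

lemma A_refine:
  assumes "i \<le> j" "j \<le> N" "U \<in> A i" "U' \<in> A j" "x \<in> U" "x \<in> U'"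
  shows "U \<subseteq> U'"
proof -
  have "U \<in> comps G (Fs i)" "U' \<in> comps G (Fs j)" using A_sub[of i] A_sub[of j] assms by auto
  then show ?thesis using comps_refine_sub[OF Fs_mono[OF assms(1,2)] _ _ assms(5,6)] by simp
qed

lemma whole_mono:
  assumes "whole i W" "i \<le> j" "j \<le> N"
  shows "whole j W"
proof -
  obtain U where U: "U \<in> comps G (Fs i)" "W \<subseteq> U" using assms(1) by (auto simp: whole_def)
  obtain U' where "U' \<in> comps G (Fs j)" "U \<subseteq> U'"
    using comps_refine[OF Fs_mono[OF assms(2,3)] U(1)] by blast
  then show ?thesis using U(2) unfolding whole_def by (intro bexI[of _ U']) auto
qed

lemma awake_of_split:
  assumes "i \<le> N" "{a, b} \<in> dem G" "U \<in> comps G (Fs i)" "a \<in> U" "b \<notin> U"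
  shows "awake i a"
proof -
  have "{a, b} \<in> sep G U" using assms by (auto simp: sep_def)
  then show ?thesis using A_sep[OF assms(1,3)] assms(4) unfolding awake_def by blast
qed

text \<open>As long as the partners are in different components, the unmet demand keeps
  \<open>b\<close> awake; once they share a component, \<open>b\<close> is awake together with
  \<open>a\<close>.\<close>

lemma core_dem_closed:
  assumes "W \<in> trees" "{a, b} \<in> dem G" "a \<in> core W"
  shows "b \<in> core W"
proof -
  obtain W' where W': "W' \<in> trees" "{a, b} \<subseteq> W'" using dem_in_tree[OF assms(2)] by blast
  have "a \<in> W" using assms(3) core_sub by blast
  then have "W' = W" using tree_disjoint[OF W'(1) assms(1), of a] W' by blast
  then have bW: "b \<in> W" using W' by blast
  have ab: "a \<in> V G" "b \<in> V G" using wf_dem[OF wf assms(2)] by auto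
  have "awake j b" if j: "j \<le> N" "\<not> whole j W" for j
  proof -
    have "awake j a" using assms(3) j by (auto simp: core_def split: if_splits)
    then obtain U where U: "U \<in> A j" "a \<in> U" by (auto simp: awake_def)
    show ?thesis
    proof (cases "b \<in> U")
      case True
      then show ?thesis using U unfolding awake_def by blast
    next
      case False
      obtain U' where U': "U' \<in> comps G (Fs j)" "b \<in> U'" using comps_cover[of b G "Fs j"] ab by blast
      then have "a \<notin> U'" using comps_eq[of U' G "Fs j" U a] U False A_sub[OF j(1)] by blast
      moreover have "{b, a} \<in> dem G" using assms(2) by (simp add: insert_commute)
      ultimately show ?thesis using awake_of_split[OF j(1) _ U'] by blast
    qed
  qed
  then show ?thesis using bW assms(3) by (auto simp: core_def split: if_splits)
qed

text \<open>Up to phase \<open>i\<close> the unmet demand keeps \<open>a\<close> awake, since its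
  component lies inside \<open>U\<close> and misses \<open>b\<close>. Later \<open>a\<close> shares
  the active moat of the core vertex \<open>v\<close> until the tree is whole.\<close>

lemma core_absorb:
  assumes "i \<le> N" "U \<in> A i" "v \<in> U" "v \<in> core W" "a \<in> U" "a \<in> W" "{a, b} \<in> dem G" "b \<notin> U"
  shows "a \<in> core W"
proof -
  have aV: "a \<in> V G" using wf_dem[OF wf assms(7)] by auto
  have "awake j a" if j: "j \<le> N" "\<not> whole j W" for j
  proof (cases "j \<le> i")
    case True
    obtain U' where U': "U' \<in> comps G (Fs j)" "a \<in> U'" using comps_cover[of a G "Fs j"] aV by blast
    have "U' \<subseteq> U" using comps_refine_sub[OF Fs_mono[OF True assms(1)] U'(1) _ U'(2)] assms A_sub[OF assms(1)] by auto
    then show ?thesis using awake_of_split[OF j(1) assms(7) U'] assms(8) by blast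
  next
    case False
    have "awake j v" using assms(4) j by (auto simp: core_def split: if_splits)
    then obtain U' where U': "U' \<in> A j" "v \<in> U'" by (auto simp: awake_def)
    have "U \<subseteq> U'" using A_refine[OF _ j(1) assms(2) U'(1) assms(3) U'(2)] False by simp
    then show ?thesis using U' assms(5) unfolding awake_def by blast
  qed
  then show ?thesis using assms(4,6) by (auto simp: core_def split: if_splits)
qed

text \<open>The demands of a leaf moat belong to the one tree it cuts. The inner partner joins the
  core by \<open>core_absorb\<close>, the outer one by \<open>core_dem_closed\<close>.\<close>

lemma leaves_sep_core:
  assumes "i \<le> N" "W \<in> trees" "U \<in> leaves i W" "d \<in> sep G U"
  shows "d \<subseteq> core W"
proof -
  obtain W' where W': "W' \<in> trees" "d \<subseteq> W'" "cuts U W'" using sep_cuts[OF assms(4)] by blast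
  then have dW: "d \<subseteq> W" using deg1_cut_unique[of U W W'] assms(2,3) by (auto simp: leaves_def)
  obtain a b where ab: "d = {a, b}" "a \<in> U" "b \<notin> U" "d \<in> dem G" using sep_dem[OF wf assms(4)] by blast
  obtain v where v: "v \<in> U" "v \<in> core W" using assms(3) by (auto simp: leaves_def)
  have "a \<in> core W" using core_absorb[OF assms(1) _ v] ab dW assms(3) by (auto simp: leaves_def)
  then show ?thesis using core_dem_closed[OF assms(2), of a b] ab by blast
qed

text \<open>The right side depends on \<open>U\<close> only through the trace
  \<open>U \<inter> core W\<close>. This carries separated demands from one phase to
  another.\<close>

lemma leaves_sep_eq:
  assumes "i \<le> N" "W \<in> trees" "U \<in> leaves i W"
  shows "sep G U = {d \<in> dem G. d \<subseteq> core W \<and> d \<inter> (U \<inter> core W) \<noteq> {} \<and> d - (U \<inter> core W) \<noteq> {}}"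
  using leaves_sep_core[OF assms] unfolding sep_def by blast

lemma leaves_sep_ne: "U \<in> leaves i W \<Longrightarrow> sep G U \<noteq> {}"
  using sep_of_deg1 by (auto simp: leaves_def)

lemma leaves_sub_hit: "leaves i W \<subseteq> hit i W"
  by (auto simp: leaves_def hit_def)

lemma leaves_finite: "i \<le> N \<Longrightarrow> finite (leaves i W)"
  using leaves_sub_hit hit_finite finite_subset by blast

lemma leaves_not_whole:
  assumes "i \<le> N" "U \<in> leaves i W"
  shows "\<not> whole i W"
proof
  assume "whole i W"
  then obtain U' where U': "U' \<in> comps G (Fs i)" "W \<subseteq> U'" by (auto simp: whole_def)
  have U: "U \<in> comps G (Fs i)" "U \<inter> W \<noteq> {}" "W - U \<noteq> {}"
    using assms A_sub by (auto simp: leaves_def cuts_def)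
  then show False using comps_eq[OF U(1) U'(1)] U' by blast
qed

lemma hit_cover:
  assumes "i \<le> N" "\<not> whole i W" "v \<in> core W"
  shows "\<exists>U\<in>hit i W. v \<in> U"
proof -
  have "awake i v" using assms by (auto simp: core_def split: if_splits)
  then show ?thesis using assms(3) unfolding awake_def hit_def by blast
qed

text \<open>The outer partner of a separated pair is a core vertex as well, hence awake in a second
  moat.\<close>

lemma leaves_hit_two:
  assumes "i \<le> N" "W \<in> trees" "U \<in> leaves i W"
  shows "2 \<le> card (hit i W)"
proof -
  obtain d where d: "d \<in> sep G U" using leaves_sep_ne[OF assms(3)] by blast
  obtain a b where ab: "d = {a, b}" "a \<in> U" "b \<notin> U" using sep_dem[OF wf d] by blast
  have "b \<in> core W" using leaves_sep_core[OF assms d] ab by blast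
  then obtain U' where U': "U' \<in> hit i W" "b \<in> U'"
    using hit_cover[OF assms(1) leaves_not_whole[OF assms(1,3)]] by blast
  have "{U, U'} \<subseteq> hit i W" "U \<noteq> U'" using U' ab assms(3) leaves_sub_hit by auto
  then show ?thesis using card_mono[OF hit_finite[OF assms(1)], of "{U, U'}" W] by simp
qed

lemma hit_two_not_whole:
  assumes "i \<le> N" "2 \<le> card (hit i W)"
  shows "\<not> whole i W"
proof
  assume "whole i W"
  then obtain U' where U': "U' \<in> comps G (Fs i)" "W \<subseteq> U'" by (auto simp: whole_def)
  have "hit i W \<subseteq> {U'}"
  proof
    fix U assume "U \<in> hit i W"
    then have "U \<in> comps G (Fs i)" "U \<inter> W \<noteq> {}" using A_sub[OF assms(1)] core_sub by (auto simp: hit_def)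
    then show "U \<in> {U'}" using comps_eq[of U G "Fs i" U'] U' by blast
  qed
  then show False using card_mono[of "{U'}" "hit i W"] assms(2) by simp
qed

text \<open>A demand leaving one of the two moats ends at a core vertex, and the only other moat
  available for that vertex is the second one.\<close>

lemma pure_pair_sep:
  assumes "i \<le> N" "W \<in> trees" "hit i W = {U1, U2}" "U1 \<in> leaves i W" "U2 \<in> leaves i W"
  shows "sep G U1 = sep G U2"
proof -
  have *: "sep G X \<subseteq> sep G Y" if XY: "hit i W = {X, Y}" "X \<in> leaves i W" for X Y
  proof
    fix d assume d: "d \<in> sep G X"
    obtain a b where ab: "d = {a, b}" "a \<in> X" "b \<notin> X" "d \<in> dem G" using sep_dem[OF wf d] by blast
    have "b \<in> core W" using leaves_sep_core[OF assms(1,2) XY(2) d] ab by blast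
    then have b: "b \<in> Y"
      using hit_cover[OF assms(1) leaves_not_whole[OF assms(1) XY(2)]] XY(1) ab by blast
    have "X \<in> A i" "Y \<in> A i" using XY(1) by (auto simp: hit_def)
    then have "a \<notin> Y" using A_eq[OF assms(1), of X Y a] ab b by blast
    then show "d \<in> sep G Y" using ab b by (auto simp: sep_def)
  qed
  have "hit i W = {U2, U1}" using assms(3) by auto
  then show ?thesis using *[OF assms(3,4)] *[OF _ assms(5)] by blast
qed

section \<open>Evolution of the moats at a core\<close>

lemma hit_parent:
  assumes "i \<le> j" "j \<le> N" "\<not> whole j W" "U \<in> hit i W"
  shows "\<exists>U'\<in>hit j W. U \<subseteq> U'"
proof -
  obtain v where v: "v \<in> U" "v \<in> core W" "U \<in> A i" using assms(4) by (auto simp: hit_def)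
  obtain U' where U': "U' \<in> hit j W" "v \<in> U'" using hit_cover[OF assms(2,3) v(2)] by blast
  then have "U \<subseteq> U'" using A_refine[OF assms(1,2) v(3) _ v(1) U'(2)] by (auto simp: hit_def)
  then show ?thesis using U' by blast
qed

lemma hit_child:
  assumes "i \<le> j" "j \<le> N" "\<not> whole j W" "U' \<in> hit j W" "v \<in> U'" "v \<in> core W"
  shows "\<exists>U\<in>hit i W. v \<in> U \<and> U \<subseteq> U'"
proof -
  have "i \<le> N" "\<not> whole i W" using assms whole_mono by auto
  then obtain U where U: "U \<in> hit i W" "v \<in> U" using hit_cover assms(6) by blast
  then have "U \<subseteq> U'" using A_refine[OF assms(1,2) _ _ U(2) assms(5)] assms(4) by (auto simp: hit_def)
  then show ?thesis using U by blast
qed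

lemma hit_card_mono:
  assumes "i \<le> j" "j \<le> N" "\<not> whole j W"
  shows "card (hit j W) \<le> card (hit i W)"
proof -
  define f where "f U = (SOME U'. U' \<in> hit j W \<and> U \<subseteq> U')" for U
  have f: "f U \<in> hit j W \<and> U \<subseteq> f U" if "U \<in> hit i W" for U
    unfolding f_def by (rule someI_ex) (use hit_parent[OF assms that] in blast)
  have "hit j W \<subseteq> f ` hit i W"
  proof
    fix U' assume U': "U' \<in> hit j W"
    then obtain v where v: "v \<in> U'" "v \<in> core W" by (auto simp: hit_def)
    obtain U where U: "U \<in> hit i W" "v \<in> U" using hit_child[OF assms U' v] by blast
    have "f U = U'" using f[OF U(1)] U(2) v U' A_eq[OF assms(2), of "f U" U' v] by (auto simp: hit_def)
    then show "U' \<in> f ` hit i W" using U by blast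
  qed
  moreover have "i \<le> N" using assms by simp
  ultimately show ?thesis by (rule surj_card_le[OF hit_finite, rotated])
qed

text \<open>At most three blocks refining two: one of the two is left intact.\<close>

lemma shared_block_aux:
  assumes "i \<le> j" "j \<le> N" "\<not> whole j W" "card (hit i W) \<le> 3" "card (hit j W) = 2"
  shows "\<exists>U\<in>hit i W. \<exists>U'\<in>hit j W. U \<inter> core W = U' \<inter> core W"
proof (rule ccontr)
  assume neg: "\<not> ?thesis"
  have iN: "i \<le> N" using assms by simp
  \<comment> \<open>A moat of phase \<open>j\<close> whose trace is not that of a single earlier
    moat contains at least two of them; two such moats would need four.\<close>
  have two: "2 \<le> card {U \<in> hit i W. U \<subseteq> P}" if P: "P \<in> hit j W" for P
  proof -
    obtain v where v: "v \<in> P" "v \<in> core W" using P by (auto simp: hit_def)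
    obtain U where U: "U \<in> hit i W" "v \<in> U" "U \<subseteq> P" using hit_child[OF assms(1-3) P v] by blast
    then have "U \<inter> core W \<noteq> P \<inter> core W" using neg P by blast
    then obtain w where w: "w \<in> P" "w \<in> core W" "w \<notin> U" using U by blast
    obtain U2 where U2: "U2 \<in> hit i W" "w \<in> U2" "U2 \<subseteq> P" using hit_child[OF assms(1-3) P w(1,2)] by blast
    have "{U, U2} \<subseteq> {U \<in> hit i W. U \<subseteq> P}" "U \<noteq> U2" using U U2 w by auto
    then show ?thesis using card_mono[of "{U \<in> hit i W. U \<subseteq> P}" "{U, U2}"] hit_finite[OF iN] by simp
  qed
  obtain P Q where PQ: "hit j W = {P, Q}" "P \<noteq> Q" using assms(5) by (auto simp: card_2_iff)
  have disj: "{U \<in> hit i W. U \<subseteq> P} \<inter> {U \<in> hit i W. U \<subseteq> Q} = {}"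
  proof -
    have "U \<noteq> {}" if "U \<in> hit i W" for U using that by (auto simp: hit_def)
    moreover have "P \<inter> Q = {}" using A_eq[OF assms(2), of P Q] PQ by (auto simp: hit_def)
    ultimately show ?thesis by blast
  qed
  have "card ({U \<in> hit i W. U \<subseteq> P} \<union> {U \<in> hit i W. U \<subseteq> Q}) \<ge> 4"
    using card_Un_disjoint[OF _ _ disj] hit_finite[OF iN] two[of P] two[of Q] PQ by simp
  moreover have "card ({U \<in> hit i W. U \<subseteq> P} \<union> {U \<in> hit i W. U \<subseteq> Q}) \<le> card (hit i W)"
    using hit_finite[OF iN] by (intro card_mono) auto
  ultimately show False using assms(4) by simp
qed

text \<open>Both time orders occur. If \<open>j\<close> comes first, the moats at the core can only
  merge, so both counts are 2 and the roles may be exchanged.\<close>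

lemma shared_block:
  assumes "i \<le> N" "j \<le> N" "2 \<le> card (hit i W)" "card (hit i W) \<le> 3" "card (hit j W) = 2"
  shows "\<exists>U\<in>hit i W. \<exists>U'\<in>hit j W. U \<inter> core W = U' \<inter> core W"
proof -
  have nw: "\<not> whole i W" "\<not> whole j W" using hit_two_not_whole assms by auto
  show ?thesis
  proof (cases "i \<le> j")
    case True
    then show ?thesis using shared_block_aux[OF True assms(2) nw(2) assms(4,5)] by blast
  next
    case False
    then have ji: "j \<le> i" by simp
    then have "card (hit i W) = 2" using hit_card_mono[OF ji assms(1) nw(1)] assms by simp
    then obtain U U' where "U \<in> hit j W" "U' \<in> hit i W" "U \<inter> core W = U' \<inter> core W"
      using shared_block_aux[OF ji assms(1) nw(1)] assms(5) by auto
    then show ?thesis by (intro bexI[of _ U'] bexI[of _ U]) auto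
  qed
qed

text \<open>A moat escapes if an unbroken chain of active moats leads from it to one without OPT edges. Budget
held by moats that do not escape can only be consumed at OPT edges.\<close>

definition escapes :: "nat \<Rightarrow> 'a set \<Rightarrow> bool" where
  "escapes i U \<longleftrightarrow> (\<exists>j. i \<le> j \<and> j \<le> N \<and> (\<exists>U'\<in>A j. U \<subseteq> U' \<and> deg U' = 0) \<and>
     (\<forall>r. i \<le> r \<and> r \<le> j \<longrightarrow> (\<exists>X\<in>A r. U \<subseteq> X)))"

text \<open>A moat without OPT edges that meets \<open>W\<close> contains all of \<open>W\<close>,
  so the tree is whole at the end of the chain. A vertex of \<open>U\<close> with an unmet demand is
  awake up to phase \<open>i\<close> by this demand and afterwards by the chain, so it would belong
  to the core.\<close>

lemma lost_not_escapes:
  assumes "i \<le> N" "U \<in> lost i"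
  shows "\<not> escapes i U"
proof
  assume "escapes i U"
  then obtain j U' where j: "i \<le> j" "j \<le> N" "U' \<in> A j" "U \<subseteq> U'" "deg U' = 0"
    and chain: "\<And>r. i \<le> r \<Longrightarrow> r \<le> j \<Longrightarrow> \<exists>X\<in>A r. U \<subseteq> X"
    unfolding escapes_def by blast
  have U: "U \<in> A i" "deg U = 1" using assms(2) by (auto simp: lost_def)
  then obtain d where d: "d \<in> sep G U" using sep_of_deg1 by blast
  obtain W where W: "W \<in> trees" "d \<subseteq> W" "cuts U W" using sep_cuts[OF d] by blast
  obtain a b where ab: "d = {a, b}" "a \<in> U" "b \<notin> U" "d \<in> dem G" "a \<in> V G" using sep_dem[OF wf d] by blast
  have "\<not> cuts U' W" using deg_pos_of_cuts[OF W(1), of U'] j(5) by auto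
  moreover have "U' \<inter> W \<noteq> {}" using W(3) j(4) by (auto simp: cuts_def)
  ultimately have "W \<subseteq> U'" by (auto simp: cuts_def)
  then have whole: "whole j W" using j A_sub[OF j(2)] by (auto simp: whole_def)
  have "awake r a" if r: "r \<le> N" "\<not> whole r W" for r
  proof (cases "r \<le> i")
    case True
    obtain X where X: "X \<in> comps G (Fs r)" "a \<in> X" using comps_cover[of a G "Fs r"] ab(5) by blast
    have "X \<subseteq> U" using comps_refine_sub[OF Fs_mono[OF True assms(1)] X(1) _ X(2)] U ab A_sub[OF assms(1)] by blast
    then show ?thesis using awake_of_split[OF r(1) _ X] ab by blast
  next
    case False
    have "r \<le> j" using whole_mono[OF whole _ r(1)] r(2) by linarith
    then show ?thesis using chain[of r] False ab(2) unfolding awake_def by auto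
  qed
  then have "a \<in> core W" using whole j(2) W(2) ab(1) by (auto simp: core_def)
  then show False using assms(2) W ab(2) by (auto simp: lost_def)
qed

definition stuck :: "nat \<Rightarrow> 'a set set" where
  "stuck i = {U \<in> A i. \<not> escapes i U}"

text \<open>Budget left in a stuck moat only moves into a stuck moat: a successor with positive
  budget is active, and if it escaped, prepending phase \<open>i\<close> to its chain would let
  \<open>U\<close> escape. Budget from other moats may flow in, hence an inequality.\<close>

lemma stuck_budget_step:
  assumes i: "i < N"
  shows "(\<Sum>U\<in>stuck i. bud i U) + len i * (eps * card {U \<in> stuck i. sep G U \<noteq> {}} - card {U \<in> stuck i. sep G U = {}})
    \<le> (\<Sum>U\<in>stuck (Suc i). bud (Suc i) U)"
proof -
  define fin where "fin U = bud i U + len i * (if sep G U \<noteq> {} then eps else if U \<in> A i then -1 else 0)" for U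
  have iN: "i \<le> N" "Suc i \<le> N" using i by auto
  have fS: "finite (stuck i)" "finite (stuck (Suc i))"
    using A_finite iN by (auto simp: stuck_def)
  have fin_nonneg: "fin U \<ge> 0" if "U \<in> comps G (Fs i)" for U
    unfolding fin_def using bud_end_nonneg[OF i that] .
  have sub: "stuck i \<subseteq> comps G (Fs i)" "stuck (Suc i) \<subseteq> comps G (Fs (Suc i))"
    using A_sub[OF iN(1)] A_sub[OF iN(2)] by (auto simp: stuck_def)
  have "(\<Sum>U\<in>stuck i. if sep G U \<noteq> {} then eps else - 1) =
      (\<Sum>U\<in>{U \<in> stuck i. sep G U \<noteq> {}}. eps) + (\<Sum>U\<in>{U \<in> stuck i. sep G U = {}}. - 1)"
    by (subst sum.If_cases[OF fS(1)]) (simp_all add: Int_def Collect_conj_eq[symmetric] Compl_eq)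
  also have "\<dots> = eps * card {U \<in> stuck i. sep G U \<noteq> {}} - card {U \<in> stuck i. sep G U = {}}"
    by simp
  finally have rate: "(\<Sum>U\<in>stuck i. if sep G U \<noteq> {} then eps else - 1) =
      eps * card {U \<in> stuck i. sep G U \<noteq> {}} - card {U \<in> stuck i. sep G U = {}}" .
  have "(\<Sum>U\<in>stuck i. fin U) = (\<Sum>U\<in>stuck i. bud i U + len i * (if sep G U \<noteq> {} then eps else - 1))"
    by (rule sum.cong) (auto simp: fin_def stuck_def)
  also have "\<dots> = (\<Sum>U\<in>stuck i. bud i U) + len i * (eps * card {U \<in> stuck i. sep G U \<noteq> {}} - card {U \<in> stuck i. sep G U = {}})"
    by (simp add: sum.distrib sum_distrib_left[symmetric] rate)
  finally have lhs: "(\<Sum>U\<in>stuck i. fin U) = (\<Sum>U\<in>stuck i. bud i U) +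
      len i * (eps * card {U \<in> stuck i. sep G U \<noteq> {}} - card {U \<in> stuck i. sep G U = {}})" .
  define D where "D P = {U \<in> comps G (Fs i). U \<subseteq> P}" for P
  have fD: "finite (D P)" for P using comps_finite[OF wf] by (simp add: D_def)
  have bud': "bud (Suc i) P = sum fin (D P)" if "P \<in> comps G (Fs (Suc i))" for P
    using bud_step[OF i that] by (simp add: fin_def D_def)
  have disj: "D P \<inter> D Q = {}" if "P \<in> comps G (Fs (Suc i))" "Q \<in> comps G (Fs (Suc i))" "P \<noteq> Q" for P Q
    using comps_nonempty comps_eq[OF that(1,2)] that(3) unfolding D_def by blast
  \<comment> \<open>Moats with exhausted budget are dropped, since their successor may be
    inactive.\<close>
  have "(\<Sum>U\<in>stuck i. fin U) = (\<Sum>U\<in>{U \<in> stuck i. fin U > 0}. fin U)"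
    using fin_nonneg sub(1) fS(1) by (intro sum.mono_neutral_right) force+
  also have "\<dots> \<le> sum fin (\<Union>P\<in>stuck (Suc i). D P)"
  proof (rule sum_mono2)
    show "finite (\<Union>P\<in>stuck (Suc i). D P)" using fS fD by blast
    show "{U \<in> stuck i. 0 < fin U} \<subseteq> (\<Union>P\<in>stuck (Suc i). D P)"
    proof
      fix U assume "U \<in> {U \<in> stuck i. 0 < fin U}"
      then have U: "U \<in> stuck i" "fin U > 0" "U \<in> comps G (Fs i)" using sub by auto
      obtain P where P: "P \<in> comps G (Fs (Suc i))" "U \<subseteq> P"
        using comps_refine[OF Fs_mono[of i "Suc i"] U(3)] iN by auto
      have "U \<in> D P" using P U by (auto simp: D_def)
      then have "fin U \<le> sum fin (D P)"
        using fin_nonneg fD by (intro member_le_sum) (auto simp: D_def)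
      then have "P \<in> A (Suc i)" using bud_active[OF iN(2) P(1)] bud'[OF P(1)] U(2) by linarith
      moreover have "\<not> escapes (Suc i) P"
      proof
        assume "escapes (Suc i) P"
        then obtain j U' where j: "Suc i \<le> j" "j \<le> N" "U' \<in> A j" "P \<subseteq> U'" "deg U' = 0"
          and chain: "\<And>r. Suc i \<le> r \<Longrightarrow> r \<le> j \<Longrightarrow> \<exists>X\<in>A r. P \<subseteq> X"
          unfolding escapes_def by blast
        have "\<exists>X\<in>A r. U \<subseteq> X" if "i \<le> r" "r \<le> j" for r
        proof (cases "r = i")
          case True
          then show ?thesis using U(1) by (auto simp: stuck_def)
        next
          case False
          then have "Suc i \<le> r" using that by simp
          then show ?thesis using chain[of r] that(2) P(2) by blast
        qed
        moreover have "U \<subseteq> U'" using P j by blast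
        ultimately have "escapes i U"
          unfolding escapes_def using j by (intro exI[of _ j]) auto
        then show False using U(1) by (auto simp: stuck_def)
      qed
      ultimately show "U \<in> (\<Union>P\<in>stuck (Suc i). D P)"
        using \<open>U \<in> D P\<close> by (auto simp: stuck_def)
    qed
    show "\<And>U. U \<in> (\<Union>P\<in>stuck (Suc i). D P) - {U \<in> stuck i. 0 < fin U} \<Longrightarrow> 0 \<le> fin U"
      using fin_nonneg by (auto simp: D_def)
  qed
  also have "\<dots> = (\<Sum>P\<in>stuck (Suc i). sum fin (D P))"
    using fS fD disj sub(2) by (intro sum.UNION_disjoint) blast+
  also have "\<dots> = (\<Sum>P\<in>stuck (Suc i). bud (Suc i) P)"
    using bud' sub(2) by (intro sum.cong) auto
  finally show ?thesis using lhs by simp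
qed

text \<open>No moat is active in state \<open>N\<close>, so the stuck moats end with total budget 0.
  What demand-active stuck moats create at rate \<open>eps\<close> is thus at most what
  budget-active stuck moats consume at rate 1, and each consumer has degree at least 2.\<close>

lemma lost_bound:
  "2 * eps * (\<Sum>i<N. len i * card (lost i)) \<le> (\<Sum>i<N. len i * (\<Sum>U\<in>{U \<in> A i. sep G U = {}}. deg U))"
proof -
  define r where "r i = eps * card {U \<in> stuck i. sep G U \<noteq> {}} - card {U \<in> stuck i. sep G U = {}}" for i
  have "(\<Sum>i<n. len i * r i) \<le> (\<Sum>U\<in>stuck n. bud n U)" if "n \<le> N" for n
    using that
  proof (induction n)
    case 0
    have "stuck 0 \<subseteq> comps G (Fs 0)" using A_sub[of 0] by (auto simp: stuck_def)
    then show ?case using bud_nonneg[of 0] by (auto intro!: sum_nonneg)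
  next
    case (Suc n)
    then show ?case using stuck_budget_step[of n] by (simp add: r_def)
  qed
  from this[of N] have tot: "(\<Sum>i<N. len i * r i) \<le> 0" using A_last by (simp add: stuck_def)
  have "2 * eps * (\<Sum>i<N. len i * card (lost i)) - (\<Sum>i<N. len i * (\<Sum>U\<in>{U \<in> A i. sep G U = {}}. deg U))
      = (\<Sum>i<N. len i * (2 * eps * card (lost i) - (\<Sum>U\<in>{U \<in> A i. sep G U = {}}. deg U)))"
    by (simp add: sum_distrib_left sum_subtractf algebra_simps)
  also have "\<dots> \<le> (\<Sum>i<N. len i * (2 * r i))"
  proof (rule sum_mono)
    fix i assume "i \<in> {..<N}"
    then have i: "i < N" "i \<le> N" by auto
    have "lost i \<subseteq> {U \<in> stuck i. sep G U \<noteq> {}}"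
      using lost_not_escapes[OF i(2)] sep_of_deg1 unfolding stuck_def by (auto simp: lost_def)
    then have c1: "card (lost i) \<le> card {U \<in> stuck i. sep G U \<noteq> {}}"
      using A_finite[OF i(2)] by (intro card_mono) (auto simp: stuck_def)
    \<comment> \<open>Degree 0 would be an escape with \<open>j = i\<close>; degree 1 would separate
      a demand by \<open>sep_of_deg1\<close>.\<close>
    have d2: "2 \<le> deg U" if "U \<in> stuck i" "sep G U = {}" for U
    proof -
      have U: "U \<in> A i" "\<not> escapes i U" using that(1) by (auto simp: stuck_def)
      have "\<exists>X\<in>A r. U \<subseteq> X" if "i \<le> r \<and> r \<le> i" for r
      proof -
        have "r = i" using that by simp
        then show ?thesis using U(1) by auto
      qed
      then have "deg U = 0 \<Longrightarrow> escapes i U"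
        unfolding escapes_def using U(1) i(2) by (intro exI[of _ i]) auto
      then have "deg U \<noteq> 0" using U(2) by blast
      moreover have "deg U \<noteq> 1" using sep_of_deg1 that by blast
      ultimately show ?thesis by simp
    qed
    have "card {U \<in> stuck i. sep G U = {}} * 2 \<le> (\<Sum>U\<in>{U \<in> stuck i. sep G U = {}}. deg U)"
      using sum_bounded_below[of "{U \<in> stuck i. sep G U = {}}" "2::nat" deg] d2 by simp
    also have "\<dots> \<le> (\<Sum>U\<in>{U \<in> A i. sep G U = {}}. deg U)"
      using A_finite[OF i(2)] by (intro sum_mono2) (auto simp: stuck_def)
    finally have c2: "2 * real (card {U \<in> stuck i. sep G U = {}}) \<le> real (\<Sum>U\<in>{U \<in> A i. sep G U = {}}. deg U)"
      by linarith
    have "eps * card (lost i) \<le> eps * card {U \<in> stuck i. sep G U \<noteq> {}}"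
      using c1 eps_pos by simp
    then show "len i * (2 * eps * card (lost i) - (\<Sum>U\<in>{U \<in> A i. sep G U = {}}. deg U)) \<le> len i * (2 * r i)"
      using c2 len_pos[OF i(1)] by (intro mult_left_mono) (auto simp: r_def)
  qed
  also have "\<dots> = 2 * (\<Sum>i<N. len i * r i)" by (simp add: sum_distrib_left algebra_simps)
  finally show ?thesis using tot by linarith
qed

section \<open>Gain from merging the cores\<close>

definition busy :: "nat \<Rightarrow> 'a set set" where
  "busy i = {W \<in> trees. 2 \<le> card (hit i W)}"

text \<open>Dropping empty cores makes \<open>core\<close> injective on the remaining trees, so the
  cost of the collection is a sum over trees.\<close>

definition cores :: "'a set set" where
  "cores = core ` {W \<in> trees. core W \<noteq> {}}"

lemma busy_finite: "finite (busy i)"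
  using trees_finite by (simp add: busy_def)

lemma busy_hit_cuts:
  assumes "i \<le> N" "W \<in> busy i" "U \<in> hit i W"
  shows "cuts U W"
proof -
  have "\<not> hit i W \<subseteq> {U}"
    using assms(2) card_mono[of "{U}" "hit i W"] by (auto simp: busy_def)
  then obtain U' where U': "U' \<in> hit i W" "U' \<noteq> U" by blast
  then obtain v where v: "v \<in> U'" "v \<in> core W" by (auto simp: hit_def)
  have "U \<in> A i" "U' \<in> A i" using U' assms(3) by (auto simp: hit_def)
  then have "v \<notin> U" using A_eq[OF assms(1), of U U' v] U' v by blast
  moreover obtain u where "u \<in> U" "u \<in> core W" using assms(3) by (auto simp: hit_def)
  ultimately show ?thesis using v core_sub[of W] unfolding cuts_def by blast
qed

text \<open>The core of a busy tree merges all moats that it meets, so one representative per busy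
  tree and the moats meeting no such core reach every class.\<close>

lemma card_merged_le:
  assumes "i \<le> N"
  shows "card (merged (A i) cores) \<le> card {U \<in> A i. \<forall>W\<in>busy i. U \<notin> hit i W} + card (busy i)"
proof -
  define R where "R = (merge_rel (A i) cores)\<^sup>*"
  define Z where "Z = {U \<in> A i. \<forall>W\<in>busy i. U \<notin> hit i W}"
  define pick where "pick W = (SOME U. U \<in> hit i W)" for W
  have pick: "pick W \<in> hit i W" if "W \<in> busy i" for W
  proof -
    have "hit i W \<noteq> {}" using that by (auto simp: busy_def)
    then show ?thesis unfolding pick_def by (simp add: some_in_eq)
  qed
  have "sym (merge_rel (A i) cores)" by (auto simp: sym_def merge_rel_def)
  then have symR: "sym R" unfolding R_def by (rule sym_rtrancl)
  have transR: "trans R" unfolding R_def by (rule trans_rtrancl)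
  have class_eq: "R `` {X} = R `` {Y}" if "(X, Y) \<in> R" for X Y
    using that symD[OF symR] transD[OF transR] by blast
  have "A i // R \<subseteq> (\<lambda>U. R `` {U}) ` Z \<union> (\<lambda>W. R `` {pick W}) ` busy i"
  proof
    fix c assume "c \<in> A i // R"
    then obtain U where U: "U \<in> A i" "c = R `` {U}" by (auto simp: quotient_def)
    show "c \<in> (\<lambda>U. R `` {U}) ` Z \<union> (\<lambda>W. R `` {pick W}) ` busy i"
    proof (cases "U \<in> Z")
      case True
      then show ?thesis using U by blast
    next
      case False
      then obtain W where W: "W \<in> busy i" "U \<in> hit i W" using U by (auto simp: Z_def)
      have "core W \<inter> U \<noteq> {}" "core W \<inter> pick W \<noteq> {}" "pick W \<in> A i"
        using W(2) pick[OF W(1)] by (auto simp: hit_def)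
      moreover have "core W \<in> cores" using \<open>core W \<inter> U \<noteq> {}\<close> W(1) by (auto simp: cores_def busy_def)
      ultimately have "(U, pick W) \<in> merge_rel (A i) cores"
        unfolding merge_rel_def using U by blast
      then have "c = R `` {pick W}" using class_eq U(2) unfolding R_def by blast
      then show ?thesis using W(1) by blast
    qed
  qed
  moreover have fin: "finite Z" "finite (busy i)" using A_finite[OF assms] busy_finite by (auto simp: Z_def)
  ultimately have "card (A i // R) \<le> card ((\<lambda>U. R `` {U}) ` Z \<union> (\<lambda>W. R `` {pick W}) ` busy i)"
    by (intro card_mono) auto
  also have "\<dots> \<le> card ((\<lambda>U. R `` {U}) ` Z) + card ((\<lambda>W. R `` {pick W}) ` busy i)"
    by (rule card_Un_le)
  also have "\<dots> \<le> card Z + card (busy i)"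
    using fin by (intro add_mono card_image_le)
  finally show ?thesis by (simp add: merged_def R_def Z_def)
qed

text \<open>Double counting of incidences between moats and busy trees. A moat that meets the cores
  of several busy trees cuts each of them, so it has at least that many OPT edges; the overcount
  beyond one is paid for by \<open>deg U - 1\<close>.\<close>

lemma rank_bound:
  assumes "i \<le> N"
  shows "(\<Sum>W\<in>busy i. real (card (hit i W)) - 1) - (\<Sum>U\<in>A i. real (deg U - 1))
    \<le> real (card (A i)) - real (card (merged (A i) cores))"
proof -
  define H where "H = {U \<in> A i. \<exists>W\<in>busy i. U \<in> hit i W}"
  define r where "r U = card {W \<in> busy i. U \<in> hit i W}" for U
  have fA: "finite (A i)" by (rule A_finite[OF assms])
  have split: "card (A i) = card {U \<in> A i. \<forall>W\<in>busy i. U \<notin> hit i W} + card H"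
  proof -
    have "A i = {U \<in> A i. \<forall>W\<in>busy i. U \<notin> hit i W} \<union> H" by (auto simp: H_def)
    then have "card (A i) = card ({U \<in> A i. \<forall>W\<in>busy i. U \<notin> hit i W} \<union> H)" by simp
    also have "\<dots> = card {U \<in> A i. \<forall>W\<in>busy i. U \<notin> hit i W} + card H"
      using fA by (intro card_Un_disjoint) (auto simp: H_def)
    finally show ?thesis .
  qed
  have hitA: "{U \<in> A i. U \<in> hit i W} = hit i W" for W by (auto simp: hit_def)
  have "(\<Sum>W\<in>busy i. card {U \<in> A i. U \<in> hit i W}) = (\<Sum>U\<in>A i. r U)"
    by (rule sum_multicount_gen) (use busy_finite fA in \<open>auto simp: r_def\<close>)
  then have dc: "(\<Sum>W\<in>busy i. card (hit i W)) = (\<Sum>U\<in>A i. r U)" by (simp add: hitA)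
  \<comment> \<open>Subtraction on naturals is truncated, so a moat without OPT edges adds 0
    here.\<close>
  have r_le: "r U \<le> (if U \<in> H then 1 else 0) + (deg U - 1)" if U: "U \<in> A i" for U
  proof (cases "U \<in> H")
    case True
    have "{W \<in> busy i. U \<in> hit i W} \<subseteq> {W \<in> trees. cuts U W}"
      using busy_hit_cuts[OF assms] by (auto simp: busy_def)
    then have "r U \<le> card {W \<in> trees. cuts U W}"
      unfolding r_def using trees_finite by (intro card_mono) auto
    then show ?thesis using card_cut_trees[of U] True by simp
  next
    case False
    then have "{W \<in> busy i. U \<in> hit i W} = {}" using U by (auto simp: H_def)
    then have "r U = 0" unfolding r_def by (metis card.empty)
    then show ?thesis by simp
  qed
  have "(\<Sum>U\<in>A i. r U) \<le> (\<Sum>U\<in>A i. (if U \<in> H then 1 else 0) + (deg U - 1))"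
    by (rule sum_mono) (rule r_le)
  also have "\<dots> = card H + (\<Sum>U\<in>A i. deg U - 1)"
  proof -
    have "A i \<inter> H = H" by (auto simp: H_def)
    then show ?thesis using fA by (simp add: sum.distrib sum.If_cases)
  qed
  finally have "(\<Sum>W\<in>busy i. card (hit i W)) \<le> card H + (\<Sum>U\<in>A i. deg U - 1)" using dc by simp
  then have "(\<Sum>W\<in>busy i. real (card (hit i W))) \<le> real (card H) + (\<Sum>U\<in>A i. real (deg U - 1))"
    by (simp only: of_nat_sum[symmetric] of_nat_add[symmetric] of_nat_le_iff)
  then show ?thesis using split card_merged_le[OF assms] by (simp add: sum_subtractf)
qed

section \<open>Unloaded cost of OPT and connection costs\<close>

definition slack :: real where
  "slack = (\<Sum>e\<in>OPT. cost G e - (\<Sum>i<N. len i * card {U \<in> A i. e \<in> delta G U}))"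

lemma slack_nonneg: "slack \<ge> 0"
  unfolding slack_def using load_le OPT_sub by (intro sum_nonneg) auto

lemma sum_edge_loads:
  assumes "E \<subseteq> OPT"
  shows "(\<Sum>e\<in>E. \<Sum>i<N. len i * card {U \<in> A i. e \<in> delta G U})
    = (\<Sum>i<N. len i * (\<Sum>U\<in>A i. card (delta G U \<inter> E)))"
proof -
  have fE: "finite E" using assms OPT_finite finite_subset by blast
  have "(\<Sum>e\<in>E. card {U \<in> A i. e \<in> delta G U}) = (\<Sum>U\<in>A i. card (delta G U \<inter> E))" if "i < N" for i
  proof (rule sum_multicount_gen)
    show "\<forall>U\<in>A i. card {e \<in> E. e \<in> delta G U} = card (delta G U \<inter> E)"
      by (auto simp: Int_def intro!: arg_cong[of _ _ card])
  qed (use fE A_finite that in auto)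
  then have "(\<Sum>i<N. len i * (\<Sum>e\<in>E. card {U \<in> A i. e \<in> delta G U}))
      = (\<Sum>i<N. len i * (\<Sum>U\<in>A i. card (delta G U \<inter> E)))" by simp
  then show ?thesis by (subst sum.swap) (simp add: sum_distrib_left)
qed

lemma cset_OPT: "cset G OPT = slack + (\<Sum>i<N. len i * (\<Sum>U\<in>A i. real (deg U)))"
  using sum_edge_loads[OF subset_refl] by (simp add: slack_def cset_def sum_subtractf deg_def)

text \<open>The edges of the spanning subtrees are paid for by the moats crossing them, up to
  \<open>slack\<close>, the cost of OPT that no moat loads. A moat with one OPT edge crosses such an
  edge only if it is a leaf cutting \<open>X W\<close>; moats of other degree are charged in full.
  It is applied to whole cores and to the terminals of connectors.\<close>

lemma conn_cost_sum_bound: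
  assumes W: "\<W> \<subseteq> trees" and X: "\<And>W. W \<in> \<W> \<Longrightarrow> X W \<subseteq> core W"
  shows "(\<Sum>W\<in>\<W>. conn_cost G (X W)) \<le> slack + (\<Sum>i<N. len i *
    ((\<Sum>W\<in>\<W>. card {U \<in> leaves i W. cuts U (X W)}) + (\<Sum>U\<in>{U \<in> A i. deg U \<noteq> 1}. deg U)))"
proof -
  define E where "E = (\<Union>W\<in>\<W>. span_edges (X W))"
  have fW: "finite \<W>" using W trees_finite finite_subset by blast
  have XW: "X W \<subseteq> W" if "W \<in> \<W>" for W using X[OF that] core_sub by blast
  have EO: "E \<subseteq> OPT" by (auto simp: E_def span_edges_def)
  have disj: "span_edges (X W) \<inter> span_edges (X W') = {}" if "W \<in> \<W>" "W' \<in> \<W>" "W \<noteq> W'" for W W'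
  proof (rule ccontr)
    assume "span_edges (X W) \<inter> span_edges (X W') \<noteq> {}"
    then obtain e where e: "e \<in> span_edges (X W)" "e \<in> span_edges (X W')" by blast
    have "e \<in> OPT" using e by (auto simp: span_edges_def)
    then show False
      using edge_tree_unique[of W W' e] span_edges_in_tree[OF _ XW e(1)] span_edges_in_tree[OF _ XW e(2)] that W
      by blast
  qed
  have "(\<Sum>W\<in>\<W>. conn_cost G (X W)) \<le> (\<Sum>W\<in>\<W>. cset G (span_edges (X W)))"
    using conn_cost_le_span XW W by (intro sum_mono) blast
  also have "\<dots> = (\<Sum>e\<in>E. cost G e)"
    unfolding cset_def E_def using fW disj OPT_finite
    by (intro sum.UNION_disjoint[symmetric]) (auto simp: span_edges_def)
  also have "\<dots> = (\<Sum>e\<in>E. cost G e - (\<Sum>i<N. len i * card {U \<in> A i. e \<in> delta G U}))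
      + (\<Sum>e\<in>E. \<Sum>i<N. len i * card {U \<in> A i. e \<in> delta G U})"
    by (simp add: sum_subtractf)
  also have "\<dots> \<le> slack + (\<Sum>e\<in>E. \<Sum>i<N. len i * card {U \<in> A i. e \<in> delta G U})"
    unfolding slack_def using load_le OPT_sub OPT_finite EO
    by (intro add_right_mono sum_mono2) auto
  also have "(\<Sum>e\<in>E. \<Sum>i<N. len i * card {U \<in> A i. e \<in> delta G U})
      = (\<Sum>i<N. len i * (\<Sum>U\<in>A i. card (delta G U \<inter> E)))" by (rule sum_edge_loads[OF EO])
  also have "\<dots> \<le> (\<Sum>i<N. len i *
    ((\<Sum>W\<in>\<W>. card {U \<in> leaves i W. cuts U (X W)}) + (\<Sum>U\<in>{U \<in> A i. deg U \<noteq> 1}. deg U)))"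
  proof (rule sum_mono)
    fix i assume "i \<in> {..<N}"
    then have i: "i < N" "i \<le> N" by auto
    have fA: "finite (A i)" by (rule A_finite[OF i(2)])
    define L where "L = (\<Union>W\<in>\<W>. {U \<in> leaves i W. cuts U (X W)})"
    have fL: "finite L" unfolding L_def using fW leaves_finite[OF i(2)] by auto
    have cE: "card (delta G U \<inter> E) \<le> deg U" for U
      unfolding deg_def using EO OPT_finite by (intro card_mono) auto
    have one: "card (delta G U \<inter> E) \<le> (if U \<in> L then 1 else 0)" if U: "U \<in> A i" "deg U = 1" for U
    proof (cases "U \<in> L")
      case True
      then show ?thesis using cE[of U] U by simp
    next
      case False
      have "e \<notin> delta G U \<inter> E" for e
      proof
        assume e: "e \<in> delta G U \<inter> E"
        obtain f where f: "delta G U \<inter> OPT = {f}" using U(2) by (auto simp: deg_def card_1_singleton_iff)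
        have "e \<in> delta G U \<inter> OPT" using e EO by blast
        then have "e = f" unfolding f by simp
        then have eq: "delta G U \<inter> OPT = {e}" using f by simp
        \<comment> \<open>The only OPT edge at \<open>U\<close> separates two vertices of
          \<open>X W'\<close>. Hence \<open>U\<close> cuts \<open>X W'\<close> and meets the core,
          so it lies in \<open>L\<close> after all.\<close>
        obtain W' u v where W': "W' \<in> \<W>" "u \<in> X W'" "v \<in> X W'" "\<not> conn G (OPT - {e}) u v"
          using e by (auto simp: E_def span_edges_def)
        have uv: "u \<in> W'" "v \<in> W'" "u \<in> core W'" "v \<in> core W'" "W' \<in> trees" using W' XW X W by auto
        have "u \<in> U \<longleftrightarrow> v \<notin> U"
          using deg1_separates[OF eq tree_conn[OF uv(5,1,2)] W'(4)] .
        then have "cuts U W'" "cuts U (X W')" "U \<inter> core W' \<noteq> {}"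
          using uv W' unfolding cuts_def by blast+
        then have "U \<in> L" using U W'(1) by (auto simp: L_def leaves_def)
        then show False using False by blast
      qed
      then have "delta G U \<inter> E = {}" by blast
      then show ?thesis by simp
    qed
    have "(\<Sum>U\<in>A i. card (delta G U \<inter> E)) =
        (\<Sum>U\<in>{U \<in> A i. deg U = 1}. card (delta G U \<inter> E)) + (\<Sum>U\<in>{U \<in> A i. deg U \<noteq> 1}. card (delta G U \<inter> E))"
      using fA by (subst sum.union_disjoint[symmetric]) (auto intro!: sum.cong)
    also have "\<dots> \<le> (\<Sum>U\<in>{U \<in> A i. deg U = 1}. if U \<in> L then 1 else 0) + (\<Sum>U\<in>{U \<in> A i. deg U \<noteq> 1}. deg U)"
      using one cE by (intro add_mono sum_mono) auto
    also have "(\<Sum>U\<in>{U \<in> A i. deg U = 1}. if U \<in> L then 1 else 0) \<le> card L"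
      using fA fL by (auto simp: sum.If_cases intro!: card_mono)
    also have "card L \<le> (\<Sum>W\<in>\<W>. card {U \<in> leaves i W. cuts U (X W)})"
      unfolding L_def by (rule card_UN_le[OF fW])
    finally have "(\<Sum>U\<in>A i. card (delta G U \<inter> E)) \<le>
      (\<Sum>W\<in>\<W>. card {U \<in> leaves i W. cuts U (X W)}) + (\<Sum>U\<in>{U \<in> A i. deg U \<noteq> 1}. deg U)" by simp
    then have "real (\<Sum>U\<in>A i. card (delta G U \<inter> E)) \<le>
      real ((\<Sum>W\<in>\<W>. card {U \<in> leaves i W. cuts U (X W)}) + (\<Sum>U\<in>{U \<in> A i. deg U \<noteq> 1}. deg U))"
      by (rule of_nat_mono)
    then show "len i * (\<Sum>U\<in>A i. card (delta G U \<inter> E)) \<le> len i *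
      ((\<Sum>W\<in>\<W>. card {U \<in> leaves i W. cuts U (X W)}) + (\<Sum>U\<in>{U \<in> A i. deg U \<noteq> 1}. deg U))"
      using len_pos[OF i(1)] by (intro mult_left_mono) auto
  qed
  finally show ?thesis by simp
qed

section \<open>Autarkic pairs and what they cover\<close>

definition paired :: "'a set \<Rightarrow> bool" where
  "paired W \<longleftrightarrow> (\<exists>i<N. card (hit i W) = 2 \<and> card (leaves i W) = 2)"

text \<open>Any phase with exactly two moats at the core, both leaves, may be chosen;
  \<open>covered_leaf\<close> transfers its separated demands to the other phases.\<close>

definition pair :: "'a set \<Rightarrow> 'a set set" where
  "pair W = hit (SOME i. i < N \<and> card (hit i W) = 2 \<and> card (leaves i W) = 2) W"

lemma pairedE:
  assumes "W \<in> trees" "paired W"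
  obtains i U1 U2 where "i < N" "pair W = hit i W" "hit i W = {U1, U2}" "leaves i W = {U1, U2}"
    "U1 \<noteq> U2" "U1 \<inter> U2 = {}" "sep G U1 = sep G U2" "sep G U1 \<noteq> {}" "U1 \<in> A i" "U2 \<in> A i"
    "psep G (pair W) = sep G U1"
proof -
  define i where "i = (SOME i. i < N \<and> card (hit i W) = 2 \<and> card (leaves i W) = 2)"
  have i: "i < N \<and> card (hit i W) = 2 \<and> card (leaves i W) = 2"
    unfolding i_def by (rule someI_ex) (use assms(2) in \<open>simp add: paired_def\<close>)
  then have iN: "i \<le> N" by simp
  have p: "pair W = hit i W" by (simp add: pair_def i_def)
  have eq: "leaves i W = hit i W"
    using card_subset_eq[OF hit_finite[OF iN] leaves_sub_hit] i by simp
  have "card (hit i W) = 2" using i by simp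
  then obtain U1 U2 where U: "hit i W = {U1, U2}" "U1 \<noteq> U2" by (meson card_2_iff)
  have L: "U1 \<in> leaves i W" "U2 \<in> leaves i W" using eq U by auto
  have UA: "U1 \<in> A i" "U2 \<in> A i" using L by (auto simp: leaves_def)
  have disj: "U1 \<inter> U2 = {}" using A_eq[OF iN UA] U(2) by blast
  have s: "sep G U1 = sep G U2" by (rule pure_pair_sep[OF iN assms(1) U(1) L])
  have "leaves i W = {U1, U2}" using eq U by simp
  moreover have "psep G (pair W) = sep G U1" using p U s by (simp add: psep_def)
  ultimately show ?thesis
    using that[of i U1 U2] i p U disj s leaves_sep_ne[OF L(1)] UA by blast
qed

lemma pair_sep: "W \<in> trees \<Longrightarrow> paired W \<Longrightarrow> U \<in> pair W \<Longrightarrow> sep G U = psep G (pair W)"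
  by (erule (1) pairedE) auto

lemma psep_pair_ne: "W \<in> trees \<Longrightarrow> paired W \<Longrightarrow> psep G (pair W) \<noteq> {}"
  by (erule (1) pairedE) simp

lemma psep_pair_core:
  assumes "W \<in> trees" "paired W" "d \<in> psep G (pair W)"
  shows "d \<subseteq> core W"
proof -
  obtain i U1 U2 where i: "i < N" "leaves i W = {U1, U2}" "psep G (pair W) = sep G U1"
    using pairedE[OF assms(1,2)] by metis
  then show ?thesis using leaves_sep_core[of i W U1 d] assms by simp
qed

text \<open>Demands separated by a pair lie in the core of its tree, and different trees are
  disjoint. This makes the collection crossing-free.\<close>

lemma psep_pair_disjoint:
  assumes "W \<in> trees" "paired W" "W' \<in> trees" "paired W'" "W \<noteq> W'"
  shows "psep G (pair W) \<inter> psep G (pair W') = {}"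
proof (rule ccontr)
  assume "psep G (pair W) \<inter> psep G (pair W') \<noteq> {}"
  then obtain d where d: "d \<in> psep G (pair W)" "d \<in> psep G (pair W')" by blast
  have "d \<in> dem G" using d(1) by (auto simp: psep_def sep_def)
  then have "d \<noteq> {}" using wf_dem[OF wf, of d] by auto
  then obtain x where "x \<in> d" by blast
  then have "x \<in> W" "x \<in> W'" using psep_pair_core assms d core_sub by blast+
  then show False using tree_disjoint[OF assms(1,3)] assms(5) by blast
qed

text \<open>\<open>shared_block\<close> yields a moat with the same trace on the core as a member of
  the pair, and by \<open>leaves_sep_eq\<close> the trace determines the separated demands. Three
  leaves are included because the connector has to be compensated there too.\<close>

lemma covered_leaf:
  assumes "i < N" "W \<in> trees" "paired W" "card (hit i W) = card (leaves i W)"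
    "2 \<le> card (leaves i W)" "card (leaves i W) \<le> 3"
  shows "\<exists>U\<in>leaves i W. sep G U = psep G (pair W)"
proof -
  obtain j U1 U2 where j: "j < N" "pair W = hit j W" "hit j W = {U1, U2}" "leaves j W = {U1, U2}" "U1 \<noteq> U2"
    using pairedE[OF assms(2,3)] by metis
  have iN: "i \<le> N" "j \<le> N" using assms(1) j(1) by auto
  have eq: "leaves i W = hit i W"
    using card_subset_eq[OF hit_finite[OF iN(1)] leaves_sub_hit] assms(4) by simp
  have "card (hit j W) = 2" using j(3,5) by simp
  then obtain U U' where U: "U \<in> hit i W" "U' \<in> hit j W" "U \<inter> core W = U' \<inter> core W"
    using shared_block[OF iN, of W] assms(4-6) by auto
  have L: "U \<in> leaves i W" "U' \<in> leaves j W" using U eq j by auto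
  have "sep G U = sep G U'"
    unfolding leaves_sep_eq[OF iN(1) assms(2) L(1)] leaves_sep_eq[OF iN(2) assms(2) L(2)] U(3) ..
  then show ?thesis using pair_sep[OF assms(2,3), of U'] U(2) j(2) L(1) by (intro bexI[of _ U]) auto
qed

lemma card_touching_le:
  assumes "i \<le> N" "finite X"
  shows "card {U \<in> A i. U \<inter> X \<noteq> {}} \<le> card X"
proof -
  define f where "f U = (SOME x. x \<in> U \<inter> X)" for U
  have f: "f U \<in> U \<inter> X" if "U \<in> {U \<in> A i. U \<inter> X \<noteq> {}}" for U
    unfolding f_def by (rule someI_ex) (use that in blast)
  show ?thesis
  proof (rule card_inj_on_le[of f])
    show "inj_on f {U \<in> A i. U \<inter> X \<noteq> {}}"
    proof (rule inj_onI)
      fix U U' assume *: "U \<in> {U \<in> A i. U \<inter> X \<noteq> {}}" "U' \<in> {U \<in> A i. U \<inter> X \<noteq> {}}" "f U = f U'"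
      then show "U = U'" using f[OF *(1)] f[OF *(2)] A_eq[OF assms(1), of U U' "f U"] by auto
    qed
  qed (use f assms(2) in auto)
qed

definition pairs :: "'a set set set" where
  "pairs = pair ` {W \<in> trees. paired W}"

definition covered :: "nat \<Rightarrow> 'a set set" where
  "covered i = {U \<in> A i. \<exists>P\<in>pairs. \<exists>X\<in>P. sep G X = sep G U}"

lemma pair_inj: "inj_on pair {W \<in> trees. paired W}"
proof (rule inj_onI, rule ccontr)
  fix W W' assume *: "W \<in> {W \<in> trees. paired W}" "W' \<in> {W \<in> trees. paired W}" "pair W = pair W'" "W \<noteq> W'"
  then have "psep G (pair W) \<inter> psep G (pair W') = {}" by (intro psep_pair_disjoint) auto
  then show False using psep_pair_ne[of W] * by simp
qed

text \<open>Separated demands of different pairs are disjoint and nonempty, so no moat is counted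
  for two trees.\<close>

lemma covered_card:
  assumes "i \<le> N"
  shows "(\<Sum>W\<in>{W \<in> trees. paired W}. card {U \<in> A i. sep G U = psep G (pair W)}) = card (covered i)"
proof -
  have "covered i = (\<Union>W\<in>{W \<in> trees. paired W}. {U \<in> A i. sep G U = psep G (pair W)})" (is "_ = ?R")
  proof
    show "covered i \<subseteq> ?R"
    proof
      fix U assume "U \<in> covered i"
      then obtain W X where W: "W \<in> trees" "paired W" "X \<in> pair W" "sep G X = sep G U" "U \<in> A i"
        by (auto simp: covered_def pairs_def)
      then show "U \<in> ?R" using pair_sep[OF W(1-3)] by auto
    qed
    show "?R \<subseteq> covered i"
    proof
      fix U assume "U \<in> ?R"
      then obtain W where W: "W \<in> trees" "paired W" "U \<in> A i" "sep G U = psep G (pair W)" by blast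
      have "pair W \<noteq> {}" using pairedE[OF W(1,2)] by (metis insert_not_empty)
      then obtain X where X: "X \<in> pair W" by blast
      have "sep G X = sep G U" using pair_sep[OF W(1,2) X] W(4) by simp
      moreover have "pair W \<in> pairs" using W by (auto simp: pairs_def)
      ultimately show "U \<in> covered i" using W(3) X unfolding covered_def by blast
    qed
  qed
  moreover have "{U \<in> A i. sep G U = psep G (pair W)} \<inter> {U \<in> A i. sep G U = psep G (pair W')} = {}"
    if "W \<in> {W \<in> trees. paired W}" "W' \<in> {W \<in> trees. paired W}" "W \<noteq> W'" for W W'
    using psep_pair_disjoint[of W W'] psep_pair_ne[of W] that by auto
  ultimately show ?thesis
    using A_finite[OF assms] trees_finite by (simp add: card_UN_disjoint)
qed

lemma leaf_bound:
  assumes "i < N" "W \<in> trees" "finite X" "card X = 2" "W \<in> busy i"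
  shows "real (card (leaves i W)) \<le> 10 / 3 * (2 * (real (card (hit i W)) - 1) - real (card (leaves i W)))
    + (if paired W then 2 * real (card {U \<in> A i. sep G U = psep G (pair W)}) - real (card {U \<in> leaves i W. cuts U X}) else 0)"
proof -
  have iN: "i \<le> N" using assms(1) by simp
  have fl: "finite (leaves i W)" by (rule leaves_finite[OF iN])
  have kn: "card (leaves i W) \<le> card (hit i W)"
    by (rule card_mono[OF hit_finite[OF iN] leaves_sub_hit])
  have n2: "2 \<le> card (hit i W)" using assms(5) by (simp add: busy_def)
  show ?thesis
  proof (cases "paired W")
    case False
    have "real (card (leaves i W)) \<le> 10 / 3 * (2 * (real (card (hit i W)) - 1) - real (card (leaves i W))) + (2 * real 0 - real 0)"
    proof (rule leaf_count_inequality)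
      \<comment> \<open>In an unpaired tree the critical case \<open>n = k = 2\<close> cannot
        occur.\<close>
      show "2 \<le> (0::nat)" if "card (hit i W) = card (leaves i W)" "card (leaves i W) = 2"
        using False that assms(1) by (auto simp: paired_def)
    qed (use n2 kn in auto)
    then show ?thesis using False by simp
  next
    case True
    define p where "p = card {U \<in> leaves i W. cuts U X}"
    define cov where "cov = card {U \<in> A i. sep G U = psep G (pair W)}"
    have fc: "finite {U \<in> A i. sep G U = psep G (pair W)}" using A_finite[OF iN] by simp
    have sub: "leaves i W \<subseteq> A i" by (auto simp: leaves_def)
    have "{U \<in> leaves i W. cuts U X} \<subseteq> {U \<in> A i. U \<inter> X \<noteq> {}}" using sub by (auto simp: cuts_def)
    then have "p \<le> card {U \<in> A i. U \<inter> X \<noteq> {}}" unfolding p_def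
      using A_finite[OF iN] by (intro card_mono) auto
    \<comment> \<open>The connector has two terminals and the moats are disjoint, so at most two of
      them touch it at a terminal.\<close>
    then have p2: "p \<le> 2" using card_touching_le[OF iN assms(3)] assms(4) by linarith
    have pk: "p \<le> card (leaves i W)" unfolding p_def using fl by (intro card_mono) auto
    have "real (card (leaves i W)) \<le> 10 / 3 * (2 * (real (card (hit i W)) - 1) - real (card (leaves i W))) + (2 * real cov - real p)"
    proof (rule leaf_count_inequality[OF n2 kn p2 pk])
      assume eq: "card (hit i W) = card (leaves i W)" and two: "card (leaves i W) = 2"
      obtain U where U: "U \<in> leaves i W" "sep G U = psep G (pair W)"
        using covered_leaf[OF assms(1,2) True eq] two by auto
      obtain U1 U2 where U12: "leaves i W = {U1, U2}" "U1 \<noteq> U2" using two by (meson card_2_iff)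
      have "leaves i W = hit i W"
        using card_subset_eq[OF hit_finite[OF iN] leaves_sub_hit] eq by simp
      then have h: "hit i W = {U1, U2}" using U12(1) by simp
      have m: "U1 \<in> leaves i W" "U2 \<in> leaves i W" using U12(1) by auto
      have "sep G U1 = sep G U2"
        using pure_pair_sep[OF iN assms(2) h m] .
      moreover have "U = U1 \<or> U = U2" using U(1) U12(1) by blast
      ultimately have "{U1, U2} \<subseteq> {U \<in> A i. sep G U = psep G (pair W)}" using U(2) m sub by auto
      then have "card {U1, U2} \<le> cov" unfolding cov_def by (rule card_mono[OF fc])
      then show "2 \<le> cov" using U12(2) by simp
    next
      assume eq: "card (hit i W) = card (leaves i W)" and three: "card (leaves i W) = 3"
      obtain U where U: "U \<in> leaves i W" "sep G U = psep G (pair W)"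
        using covered_leaf[OF assms(1,2) True eq] three by auto
      then have "{U} \<subseteq> {U \<in> A i. sep G U = psep G (pair W)}" using sub by auto
      then have "1 \<le> cov" unfolding cov_def using card_mono[OF fc, of "{U}"] by simp
      then show "p = 0 \<or> 1 \<le> cov" by simp
    qed
    then show ?thesis using True by (simp add: p_def cov_def)
  qed
qed

section \<open>Charging moats to leaves, budgets and degrees\<close>

lemma demand_count:
  assumes "i \<le> N"
  shows "card {U \<in> A i. sep G U \<noteq> {}} \<le> (\<Sum>W\<in>trees. card (leaves i W)) + card (lost i)
    + card {U \<in> A i. sep G U \<noteq> {} \<and> 2 \<le> deg U}"
proof -
  have fA: "finite (A i)" by (rule A_finite[OF assms])
  have "{U \<in> A i. sep G U \<noteq> {}} \<subseteq> ((\<Union>W\<in>trees. leaves i W) \<union> lost i) \<union> {U \<in> A i. sep G U \<noteq> {} \<and> 2 \<le> deg U}"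
  proof
    fix U assume "U \<in> {U \<in> A i. sep G U \<noteq> {}}"
    then have U: "U \<in> A i" "sep G U \<noteq> {}" by auto
    then have "deg U = 1 \<or> 2 \<le> deg U" using deg_pos_of_sep by fastforce
    then show "U \<in> ((\<Union>W\<in>trees. leaves i W) \<union> lost i) \<union> {U \<in> A i. sep G U \<noteq> {} \<and> 2 \<le> deg U}"
    proof
      assume "deg U = 1"
      then show ?thesis using U(1) unfolding leaves_def lost_def by blast
    next
      assume "2 \<le> deg U"
      then show ?thesis using U by blast
    qed
  qed
  then have "card {U \<in> A i. sep G U \<noteq> {}} \<le> card (((\<Union>W\<in>trees. leaves i W) \<union> lost i) \<union> {U \<in> A i. sep G U \<noteq> {} \<and> 2 \<le> deg U})"
    using fA trees_finite leaves_finite[OF assms] by (intro card_mono) (auto simp: lost_def)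
  also have "\<dots> \<le> card ((\<Union>W\<in>trees. leaves i W) \<union> lost i) + card {U \<in> A i. sep G U \<noteq> {} \<and> 2 \<le> deg U}"
    by (rule card_Un_le)
  also have "card ((\<Union>W\<in>trees. leaves i W) \<union> lost i) \<le> card (\<Union>W\<in>trees. leaves i W) + card (lost i)"
    by (rule card_Un_le)
  also have "card (\<Union>W\<in>trees. leaves i W) \<le> (\<Sum>W\<in>trees. card (leaves i W))"
    by (rule card_UN_le[OF trees_finite])
  finally show ?thesis by simp
qed

text \<open>Charges of a moat with \<open>d\<close> OPT edges: \<open>2 * 10/3\<close> for each edge
  beyond the first from \<open>rank_bound\<close>, \<open>10/3 + 1\<close> for every edge from the
  two connection costs, and 1 if the moat itself must be paid for. For \<open>d >= 2\<close> this is
  at most \<open>11 * d - 17/3\<close>, to be compared with \<open>17 * (d - 1)\<close>; for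
  \<open>d = 2\<close> the values are 49/3 and 17.\<close>

lemma branching_charge:
  assumes "i \<le> N"
  shows "20 / 3 * (\<Sum>U\<in>A i. real (deg U - 1)) + 13 / 3 * (\<Sum>U\<in>{U \<in> A i. deg U \<noteq> 1}. real (deg U))
     + card {U \<in> A i. sep G U \<noteq> {} \<and> 2 \<le> deg U}
    \<le> 17 * ((\<Sum>U\<in>A i. real (deg U)) - card {U \<in> A i. sep G U \<noteq> {}})"
proof -
  have fA: "finite (A i)" by (rule A_finite[OF assms])
  have card_ind: "real (card {U \<in> A i. Q U}) = (\<Sum>U\<in>A i. if Q U then 1 else 0)" for Q
    using fA by (simp add: sum.If_cases Int_def)
  have sum_ind: "(\<Sum>U\<in>{U \<in> A i. deg U \<noteq> 1}. real (deg U)) = (\<Sum>U\<in>A i. if deg U \<noteq> 1 then real (deg U) else 0)"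
    using fA by (intro sum.mono_neutral_cong_left) auto
  have "20 / 3 * (\<Sum>U\<in>A i. real (deg U - 1)) + 13 / 3 * (\<Sum>U\<in>{U \<in> A i. deg U \<noteq> 1}. real (deg U))
     + card {U \<in> A i. sep G U \<noteq> {} \<and> 2 \<le> deg U}
    = (\<Sum>U\<in>A i. 20 / 3 * real (deg U - 1) + 13 / 3 * (if deg U \<noteq> 1 then real (deg U) else 0)
        + (if sep G U \<noteq> {} \<and> 2 \<le> deg U then 1 else 0))"
    unfolding card_ind sum_ind by (simp only: sum.distrib sum_distrib_left)
  also have "\<dots> \<le> (\<Sum>U\<in>A i. 17 * (real (deg U) - (if sep G U \<noteq> {} then 1 else 0)))"
  proof (rule sum_mono)
    fix U
    consider "deg U = 0" | "deg U = 1" | "2 \<le> deg U" by linarith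
    then show "20 / 3 * real (deg U - 1) + 13 / 3 * (if deg U \<noteq> 1 then real (deg U) else 0)
        + (if sep G U \<noteq> {} \<and> 2 \<le> deg U then 1 else 0) \<le> 17 * (real (deg U) - (if sep G U \<noteq> {} then 1 else 0))"
    proof cases
      case 1
      then have "sep G U = {}" using deg_pos_of_sep[of U] by auto
      then show ?thesis using 1 by simp
    next
      case 2
      then show ?thesis by simp
    next
      case 3
      then obtain d where d: "real (deg U) = d" "real (deg U - 1) = d - 1" "d \<ge> 2" by force
      have "deg U \<noteq> 1" using 3 by simp
      then show ?thesis unfolding d(1,2) using 3 d(3) by (simp add: field_simps)
    qed
  qed
  also have "\<dots> = 17 * ((\<Sum>U\<in>A i. real (deg U)) - card {U \<in> A i. sep G U \<noteq> {}})"
    unfolding card_ind by (simp only: sum_distrib_left[symmetric] sum_subtractf)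
  finally show ?thesis .
qed

text \<open>Both orders of the members give the same unordered pair, hence a single representative.
  It lies in the core, so \<open>conn_cost_sum_bound\<close> applies to the connector.\<close>

lemma pair_terminals:
  fixes rep :: "'a set set \<Rightarrow> 'a set"
  assumes rep: "\<forall>A B. A \<noteq> B \<and> sep G A \<inter> sep G B \<noteq> {} \<longrightarrow> rep {A, B} \<in> sep G A \<inter> sep G B"
    and W: "W \<in> trees" "paired W"
  shows "terminals G rep (pair W) = rep (pair W)" "rep (pair W) \<subseteq> core W" "card (rep (pair W)) = 2"
proof -
  obtain i U1 U2 where U: "pair W = {U1, U2}" "U1 \<noteq> U2" "sep G U1 = sep G U2" "sep G U1 \<noteq> {}"
    "psep G (pair W) = sep G U1"
    using pairedE[OF W] by metis
  have "{rep {A, B} | A B. A \<in> pair W \<and> B \<in> pair W \<and> A \<noteq> B \<and> sep G A \<inter> sep G B \<noteq> {}} = {rep (pair W)}"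
  proof (intro equalityI subsetI)
    fix z assume "z \<in> {rep {A, B} | A B. A \<in> pair W \<and> B \<in> pair W \<and> A \<noteq> B \<and> sep G A \<inter> sep G B \<noteq> {}}"
    then obtain A B where z: "z = rep {A, B}" "A \<in> pair W" "B \<in> pair W" "A \<noteq> B" by blast
    then have "{A, B} = pair W" unfolding U(1) by auto
    then show "z \<in> {rep (pair W)}" using z(1) by simp
  next
    fix z assume "z \<in> {rep (pair W)}"
    then have "z = rep {U1, U2}" using U(1) by simp
    moreover have "U1 \<in> pair W" "U2 \<in> pair W" "sep G U1 \<inter> sep G U2 \<noteq> {}" using U by auto
    ultimately show "z \<in> {rep {A, B} | A B. A \<in> pair W \<and> B \<in> pair W \<and> A \<noteq> B \<and> sep G A \<inter> sep G B \<noteq> {}}"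
      using U(2) by blast
  qed
  then show "terminals G rep (pair W) = rep (pair W)" by (simp add: terminals_def)
  have "rep {U1, U2} \<in> sep G U1 \<inter> sep G U2" using rep U by auto
  then have r: "rep (pair W) \<in> sep G U1" using U(1) by simp
  then show "rep (pair W) \<subseteq> core W" using psep_pair_core[OF W] U(5) by simp
  show "card (rep (pair W)) = 2" using r wf_dem[OF wf] by (simp add: sep_def)
qed

lemma leaf_sum_bound:
  fixes X :: "'a set \<Rightarrow> 'a set"
  assumes i: "i < N" and X: "\<And>W. W \<in> trees \<Longrightarrow> paired W \<Longrightarrow> card (X W) = 2"
  shows "(\<Sum>W\<in>trees. real (card (leaves i W)))
    \<le> 10 / 3 * (2 * (\<Sum>W\<in>busy i. real (card (hit i W)) - 1) - (\<Sum>W\<in>trees. real (card (leaves i W))))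
      + (2 * real (card (covered i)) - (\<Sum>W\<in>{W \<in> trees. paired W}. real (card {U \<in> leaves i W. cuts U (X W)})))"
proof -
  define cov where "cov W = real (card {U \<in> A i. sep G U = psep G (pair W)})" for W
  define p where "p W = real (card {U \<in> leaves i W. cuts U (X W)})" for W
  define k where "k W = real (card (leaves i W))" for W
  define h where "h W = (if W \<in> busy i then real (card (hit i W)) - 1 else 0)" for W
  have iN: "i \<le> N" using i by simp
  have pt: "k W \<le> 10 / 3 * (2 * h W - k W) + (if paired W then 2 * cov W - p W else 0)" if W: "W \<in> trees" for W
  proof (cases "W \<in> busy i")
    case True
    \<comment> \<open>The connector term occurs only for paired trees; otherwise any two-element set
      can be handed to \<open>leaf_bound\<close>.\<close>
    obtain X' where X': "finite X'" "card X' = 2" "paired W \<Longrightarrow> X' = X W"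
    proof (cases "paired W")
      case True
      then have "card (X W) = 2" using X W by blast
      then show ?thesis using that[of "X W"] card.infinite by fastforce
    next
      case False
      have "2 \<le> card (hit i W)" using \<open>W \<in> busy i\<close> by (simp add: busy_def)
      then have "hit i W \<noteq> {}" by auto
      then obtain U1 where U1: "U1 \<in> hit i W" by blast
      have "\<not> hit i W \<subseteq> {U1}" using card_mono[of "{U1}" "hit i W"] \<open>2 \<le> card (hit i W)\<close> by auto
      then obtain U2 where U2: "U2 \<in> hit i W" "U2 \<noteq> U1" by blast
      obtain u1 u2 where u: "u1 \<in> U1" "u2 \<in> U2" using U1 U2 by (auto simp: hit_def)
      have "u1 \<noteq> u2" using A_eq[OF iN, of U1 U2 u1] U1 U2 u by (auto simp: hit_def)
      then show ?thesis using that[of "{u1, u2}"] False by simp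
    qed
    then show ?thesis using leaf_bound[OF i W X'(1,2) True] True X'(3)
      by (auto simp: k_def h_def cov_def p_def)
  next
    case False
    \<comment> \<open>A leaf forces two moats at the core, so a tree that is not busy has
      none.\<close>
    then have "leaves i W = {}" using leaves_hit_two[OF iN W] W by (auto simp: busy_def)
    then show ?thesis using False by (simp add: k_def h_def p_def cov_def)
  qed
  have "(\<Sum>W\<in>trees. k W) \<le> (\<Sum>W\<in>trees. 10 / 3 * (2 * h W - k W) + (if paired W then 2 * cov W - p W else 0))"
    by (rule sum_mono) (rule pt)
  also have "\<dots> = 10 / 3 * (2 * (\<Sum>W\<in>trees. h W) - (\<Sum>W\<in>trees. k W)) + (\<Sum>W\<in>trees. if paired W then 2 * cov W - p W else 0)"
    by (simp add: sum.distrib sum_distrib_left sum_subtractf right_diff_distrib)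
  also have "(\<Sum>W\<in>trees. h W) = (\<Sum>W\<in>busy i. real (card (hit i W)) - 1)"
    unfolding h_def using trees_finite by (intro sum.mono_neutral_cong_right) (auto simp: busy_def)
  also have "(\<Sum>W\<in>trees. if paired W then 2 * cov W - p W else 0) = (\<Sum>W\<in>{W \<in> trees. paired W}. 2 * cov W - p W)"
    using trees_finite by (intro sum.mono_neutral_cong_right) auto
  also have "\<dots> = 2 * (\<Sum>W\<in>{W \<in> trees. paired W}. cov W) - (\<Sum>W\<in>{W \<in> trees. paired W}. p W)"
    by (simp add: sum_subtractf sum_distrib_left)
  also have "(\<Sum>W\<in>{W \<in> trees. paired W}. cov W) = real (card (covered i))"
    unfolding cov_def covered_card[OF iN, symmetric] by simp
  finally show ?thesis by (simp add: k_def p_def)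
qed

text \<open>A linear inequality between counts of moats holds in each phase and is summed with
  weights \<open>len i\<close>. Only the lost moats are left over, and they are bounded by the
  balance over all phases.\<close>

theorem phases_bound:
  fixes rep :: "'a set set \<Rightarrow> 'a set"
  assumes rep: "\<forall>A B. A \<noteq> B \<and> sep G A \<inter> sep G B \<noteq> {} \<longrightarrow> rep {A, B} \<in> sep G A \<inter> sep G B"
  defines "Y \<equiv> \<Sum>i<N. len i * card {U \<in> A i. sep G U \<noteq> {}}"
  shows "Y \<le> 10 / 3 * (2 * (\<Sum>i<N. len i * (real (card (A i)) - real (card (merged (A i) cores)))) - cost_coll G cores)
    + (2 * (\<Sum>i<N. len i * card (covered i)) - connector_cost G rep pairs)
    + (1 / (2 * eps) + 17) * (cset G OPT - Y)"
proof -
  define PW where "PW = {W \<in> trees. paired W}"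
  define CW where "CW = {W \<in> trees. core W \<noteq> {}}"
  define X where "X W = rep (pair W)" for W
  define D where "D i = real (card {U \<in> A i. sep G U \<noteq> {}})" for i
  define k where "k i = (\<Sum>W\<in>trees. real (card (leaves i W)))" for i
  define Dg where "Dg i = (\<Sum>U\<in>{U \<in> A i. deg U \<noteq> 1}. real (deg U))" for i
  define p where "p i = (\<Sum>W\<in>PW. real (card {U \<in> leaves i W. cuts U (X W)}))" for i
  define rk where "rk i = real (card (A i)) - real (card (merged (A i) cores))" for i
  define dg where "dg i = (\<Sum>U\<in>A i. real (deg U))" for i
  define c where "c i = real (card (covered i))" for i
  define ls where "ls i = real (card (lost i))" for i
  have X2: "card (X W) = 2" "X W \<subseteq> core W" "terminals G rep (pair W) = X W" if "W \<in> PW" for W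
    using pair_terminals[OF rep] that by (auto simp: PW_def X_def)
  have "inj_on core CW"
  proof (rule inj_onI)
    fix W W' assume *: "W \<in> CW" "W' \<in> CW" "core W = core W'"
    then obtain v where "v \<in> core W" by (auto simp: CW_def)
    then have "v \<in> W" "v \<in> W'" using core_sub[of W] core_sub[of W'] *(3) by auto
    then show "W = W'" using tree_disjoint[of W W' v] * by (auto simp: CW_def)
  qed
  then have "cost_coll G cores = (\<Sum>W\<in>CW. conn_cost G (core W))"
    by (simp add: cost_coll_def cores_def sum.reindex CW_def)
  also have "\<dots> \<le> slack + (\<Sum>i<N. len i *
    ((\<Sum>W\<in>CW. card {U \<in> leaves i W. cuts U (core W)}) + (\<Sum>U\<in>{U \<in> A i. deg U \<noteq> 1}. deg U)))"
    by (rule conn_cost_sum_bound) (auto simp: CW_def)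
  also have "\<dots> \<le> slack + (\<Sum>i<N. len i * (k i + Dg i))"
  proof (intro add_left_mono sum_mono mult_left_mono)
    fix i assume i: "i \<in> {..<N}"
    have "(\<Sum>W\<in>CW. card {U \<in> leaves i W. cuts U (core W)}) \<le> (\<Sum>W\<in>CW. card (leaves i W))"
      using leaves_finite i by (intro sum_mono card_mono) auto
    also have "\<dots> \<le> (\<Sum>W\<in>trees. card (leaves i W))"
      using trees_finite by (intro sum_mono2) (auto simp: CW_def)
    finally have "real (\<Sum>W\<in>CW. card {U \<in> leaves i W. cuts U (core W)}) \<le> k i"
      unfolding k_def of_nat_sum[symmetric] by (rule of_nat_mono)
    then show "real ((\<Sum>W\<in>CW. card {U \<in> leaves i W. cuts U (core W)}) + (\<Sum>U\<in>{U \<in> A i. deg U \<noteq> 1}. deg U)) \<le> k i + Dg i"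
      by (simp add: Dg_def)
  qed (use len_pos in \<open>auto intro: less_imp_le\<close>)
  finally have costS: "cost_coll G cores \<le> slack + (\<Sum>i<N. len i * (k i + Dg i))" .
  have "connector_cost G rep pairs = (\<Sum>W\<in>PW. conn_cost G (terminals G rep (pair W)))"
    unfolding connector_cost_def pairs_def PW_def by (simp add: sum.reindex[OF pair_inj])
  also have "\<dots> = (\<Sum>W\<in>PW. conn_cost G (X W))" using X2(3) by (intro sum.cong) auto
  also have "\<dots> \<le> slack + (\<Sum>i<N. len i *
    ((\<Sum>W\<in>PW. card {U \<in> leaves i W. cuts U (X W)}) + (\<Sum>U\<in>{U \<in> A i. deg U \<noteq> 1}. deg U)))"
    by (rule conn_cost_sum_bound) (use X2(2) in \<open>auto simp: PW_def\<close>)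
  also have "\<dots> = slack + (\<Sum>i<N. len i * (p i + Dg i))"
    by (simp add: p_def Dg_def)
  finally have costP: "connector_cost G rep pairs \<le> slack + (\<Sum>i<N. len i * (p i + Dg i))" .
  have phase: "D i \<le> 10 / 3 * (2 * rk i - (k i + Dg i)) + (2 * c i - (p i + Dg i)) + 17 * (dg i - D i) + ls i"
    if i: "i < N" for i
  proof -
    have iN: "i \<le> N" using i by simp
    have a: "k i \<le> 10 / 3 * (2 * (\<Sum>W\<in>busy i. real (card (hit i W)) - 1) - k i) + (2 * c i - p i)"
      using leaf_sum_bound[OF i, of X] X2(1) unfolding k_def c_def p_def PW_def by simp
    have b: "(\<Sum>W\<in>busy i. real (card (hit i W)) - 1) - (\<Sum>U\<in>A i. real (deg U - 1)) \<le> rk i"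
      using rank_bound[OF iN] by (simp add: rk_def)
    have "D i \<le> real ((\<Sum>W\<in>trees. card (leaves i W)) + card (lost i) + card {U \<in> A i. sep G U \<noteq> {} \<and> 2 \<le> deg U})"
      unfolding D_def by (rule of_nat_mono[OF demand_count[OF iN]])
    then have d: "D i \<le> k i + ls i + card {U \<in> A i. sep G U \<noteq> {} \<and> 2 \<le> deg U}"
      by (simp add: k_def ls_def)
    have e: "20 / 3 * (\<Sum>U\<in>A i. real (deg U - 1)) + 13 / 3 * Dg i + card {U \<in> A i. sep G U \<noteq> {} \<and> 2 \<le> deg U}
      \<le> 17 * (dg i - D i)"
      using branching_charge[OF iN] by (simp add: Dg_def dg_def D_def)
    show ?thesis using a b d e by argo
  qed
  have YD: "Y = (\<Sum>i<N. len i * D i)" by (simp add: Y_def D_def)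
  \<comment> \<open>The excess is the unloaded cost of OPT plus, in each phase, the OPT edges at
    moats beyond one for every demand-active moat.\<close>
  have ex: "cset G OPT - Y = slack + (\<Sum>i<N. len i * (dg i - D i))"
    unfolding cset_OPT YD by (simp add: dg_def right_diff_distrib sum_subtractf)
  have "Y \<le> (\<Sum>i<N. len i * (10 / 3 * (2 * rk i - (k i + Dg i)) + (2 * c i - (p i + Dg i)) + 17 * (dg i - D i) + ls i))"
    unfolding YD using phase len_pos by (intro sum_mono mult_left_mono) (auto intro: less_imp_le)
  also have "\<dots> = 10 / 3 * (2 * (\<Sum>i<N. len i * rk i) - (\<Sum>i<N. len i * (k i + Dg i)))
      + (2 * (\<Sum>i<N. len i * c i) - (\<Sum>i<N. len i * (p i + Dg i)))
      + 17 * (\<Sum>i<N. len i * (dg i - D i)) + (\<Sum>i<N. len i * ls i)"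
    unfolding sum_distrib_left sum_subtractf[symmetric] sum.distrib[symmetric]
    by (rule sum.cong) (simp_all add: field_simps)
  finally have main: "Y \<le> 10 / 3 * (2 * (\<Sum>i<N. len i * rk i) - (\<Sum>i<N. len i * (k i + Dg i)))
      + (2 * (\<Sum>i<N. len i * c i) - (\<Sum>i<N. len i * (p i + Dg i)))
      + 17 * (\<Sum>i<N. len i * (dg i - D i)) + (\<Sum>i<N. len i * ls i)" .
  have "2 * eps * (\<Sum>i<N. len i * ls i) \<le> (\<Sum>i<N. len i * (\<Sum>U\<in>{U \<in> A i. sep G U = {}}. deg U))"
    unfolding ls_def by (rule lost_bound)
  \<comment> \<open>Demand-active moats have at least one OPT edge each, so the degrees of the
    budget-active ones stay within the excess.\<close>
  also have "\<dots> \<le> (\<Sum>i<N. len i * (dg i - D i))"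
  proof (intro sum_mono mult_left_mono)
    fix i assume "i \<in> {..<N}"
    then have iN: "i \<le> N" by simp
    have fA: "finite (A i)" by (rule A_finite[OF iN])
    have "dg i = (\<Sum>U\<in>{U \<in> A i. sep G U = {}}. real (deg U)) + (\<Sum>U\<in>{U \<in> A i. sep G U \<noteq> {}}. real (deg U))"
      unfolding dg_def using fA by (subst sum.union_disjoint[symmetric]) (auto intro!: sum.cong)
    moreover have "D i \<le> (\<Sum>U\<in>{U \<in> A i. sep G U \<noteq> {}}. real (deg U))"
      unfolding D_def using sum_bounded_below[of "{U \<in> A i. sep G U \<noteq> {}}" "1::real" "\<lambda>U. real (deg U)"]
        deg_pos_of_sep by force
    ultimately show "real (\<Sum>U\<in>{U \<in> A i. sep G U = {}}. deg U) \<le> dg i - D i" by simp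
  qed (use len_pos in \<open>auto intro: less_imp_le\<close>)
  also have "\<dots> \<le> cset G OPT - Y" using ex slack_nonneg by simp
  finally have "(\<Sum>i<N. len i * ls i) \<le> 1 / (2 * eps) * (cset G OPT - Y)"
    using eps_pos by (simp add: field_simps)
  \<comment> \<open>The slack enters both connection costs, with weights 10/3 and 1; their sum 13/3
    is below 17.\<close>
  moreover have "17 * (\<Sum>i<N. len i * (dg i - D i)) \<le> 17 * (cset G OPT - Y) - 13 / 3 * slack"
    using ex slack_nonneg by simp
  ultimately have "Y \<le> 10 / 3 * (2 * (\<Sum>i<N. len i * rk i) - cost_coll G cores)
      + (2 * (\<Sum>i<N. len i * c i) - connector_cost G rep pairs)
      + (17 * (cset G OPT - Y) + 1 / (2 * eps) * (cset G OPT - Y))"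
    using main costS costP by argo
  then show ?thesis by (simp add: rk_def c_def distrib_right)
qed

end

section \<open>Reduction of a run to phases\<close>

text \<open>Only right derivatives are given, so the mean value theorem does not apply. After the
  tilt by \<open>e * (x - a)\<close>, the last point where \<open>g\<close> is nonpositive has a
  negative right derivative, so it is not the last.\<close>

lemma right_derivative_nonpos_le:
  fixes f :: "real \<Rightarrow> real"
  assumes "a \<le> c" "continuous_on {a..c} f"
    and D: "\<And>t. a \<le> t \<Longrightarrow> t < c \<Longrightarrow> \<exists>D\<le>0. (f has_real_derivative D) (at t within {t..})"
  shows "f c \<le> f a"
proof (rule field_le_epsilon)
  fix e' :: real assume e': "e' > 0"
  define e where "e = e' / (c - a + 1)"
  have e: "e > 0" "e * (c - a) \<le> e'" using e' assms(1) by (auto simp: e_def field_simps)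
  define g where "g x = f x - f a - e * (x - a)" for x
  have cg: "continuous_on {a..c} g" unfolding g_def by (intro continuous_intros assms(2))
  have "g c \<le> 0"
  proof (rule ccontr)
    assume neg: "\<not> g c \<le> 0"
    define Z where "Z = {x \<in> {a..c}. g x \<le> 0}"
    define s where "s = Sup Z"
    have "closed Z" unfolding Z_def by (rule continuous_on_closed_Collect_le[OF cg]) (auto intro: continuous_intros)
    moreover have aZ: "a \<in> Z" using assms(1) by (simp add: Z_def g_def)
    moreover have bdd: "bdd_above Z" unfolding Z_def by (rule bdd_aboveI[of _ c]) auto
    ultimately have sZ: "s \<in> Z" unfolding s_def by (intro closed_contains_Sup) auto
    then have s: "a \<le> s" "s < c" "g s \<le> 0" using neg by (auto simp: Z_def order.order_iff_strict)
    obtain D' where D': "D' \<le> 0" "(f has_real_derivative D') (at s within {s..})" using D[OF s(1,2)] by blast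
    have "(g has_real_derivative (D' - e)) (at s within {s..})"
      unfolding g_def by (rule derivative_eq_intros D' refl | simp)+
    then obtain d where d: "d > 0" "\<And>h. h > 0 \<Longrightarrow> s + h \<in> {s..} \<Longrightarrow> h < d \<Longrightarrow> g (s + h) < g s"
      using has_real_derivative_neg_dec_right[of g "D' - e" s "{s..}"] D'(1) e(1) by auto
    define h where "h = min (d / 2) (c - s)"
    have h: "h > 0" "h < d" "s + h \<le> c" using d(1) s(2) by (auto simp: h_def)
    then have "g (s + h) < g s" using d(2) by simp
    then have "s + h \<in> Z" using s h by (auto simp: Z_def)
    then have "s + h \<le> s" unfolding s_def by (rule cSup_upper[OF _ bdd])
    then show False using h by simp
  qed
  then show "f c \<le> f a + e'" using e by (simp add: g_def)
qed

lemma right_derivative_const_linear: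
  fixes f :: "real \<Rightarrow> real"
  assumes "a \<le> c" "continuous_on {a..c} f"
    and D: "\<And>t. a \<le> t \<Longrightarrow> t < c \<Longrightarrow> (f has_real_derivative D) (at t within {t..})"
  shows "f c = f a + D * (c - a)"
proof -
  have "f c - D * c \<le> f a - D * a"
    by (rule right_derivative_nonpos_le[of a c "\<lambda>x. f x - D * x"])
      (auto intro!: continuous_intros assms exI[of _ 0] derivative_eq_intros)
  moreover have "D * c - f c \<le> D * a - f a"
    by (rule right_derivative_nonpos_le[of a c "\<lambda>x. D * x - f x"])
      (auto intro!: continuous_intros assms exI[of _ 0] derivative_eq_intros)
  ultimately show ?thesis by (simp add: algebra_simps)
qed

section \<open>The state of a run is piecewise constant\<close>

locale moat_growing =
  fixes G :: "('a, 'e) sf_inst" and eps :: real and y b :: "'a set \<Rightarrow> real \<Rightarrow> real"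
  assumes wf_G: "wf_inst G" and run: "moat_run G eps y b"
begin

lemma y_zero: "y S 0 = 0" and y_cont: "continuous_on {0..} (y S)"
  and y_deriv: "t \<ge> 0 \<Longrightarrow> (y S has_real_derivative (if S \<in> active G y b t then 1 else 0)) (at t within {t..})"
  and load_le_cost: "t \<ge> 0 \<Longrightarrow> e \<in> Ed G \<Longrightarrow> load G y e t \<le> cost G e"
  and b_zero: "S \<in> comps_at G y 0 \<Longrightarrow> b S 0 = 0"
  and b_deriv: "t \<ge> 0 \<Longrightarrow> S \<in> comps_at G y t \<Longrightarrow> (b S has_real_derivative
           (if demand_active G (tight G y t) S then eps
            else if budget_active G (tight G y t) b t S then -1 else 0)) (at t within {t..})"
  and b_merge: "t > 0 \<Longrightarrow> S \<in> comps_at G y t \<Longrightarrow>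
        ((\<lambda>s. \<Sum>T\<in>{T \<in> comps_at G y s. T \<subseteq> S}. b T s) \<longlongrightarrow> b S t) (at_left t)"
  using run unfolding moat_run_def by blast+

lemma y_mono: "0 \<le> s \<Longrightarrow> s \<le> t \<Longrightarrow> y S s \<le> y S t"
proof -
  assume st: "0 \<le> s" "s \<le> t"
  have "- y S t \<le> - y S s"
  proof (rule right_derivative_nonpos_le[of s t "\<lambda>x. - y S x"])
    show "continuous_on {s..t} (\<lambda>x. - y S x)"
      using st by (intro continuous_intros continuous_on_subset[OF y_cont]) auto
    fix r assume "s \<le> r" "r < t"
    then have "((\<lambda>x. - y S x) has_real_derivative - (if S \<in> active G y b r then 1 else 0)) (at r within {r..})"
      using st by (intro DERIV_minus y_deriv) auto
    then show "\<exists>D\<le>0. ((\<lambda>x. - y S x) has_real_derivative D) (at r within {r..})"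
      by (intro exI[of _ "- (if S \<in> active G y b r then 1 else 0)"]) simp
  qed (rule st)
  then show ?thesis by simp
qed

lemma tight_sub: "tight G y t \<subseteq> Ed G"
  by (auto simp: tight_def)

lemma fin_V: "finite (V G)" and fin_E: "finite (Ed G)"
  using wf_G by (auto simp: wf_inst_def)

lemma load_mono: "0 \<le> s \<Longrightarrow> s \<le> t \<Longrightarrow> load G y e s \<le> load G y e t"
  unfolding load_def by (intro sum_mono y_mono)

lemma tight_mono:
  assumes "0 \<le> s" "s \<le> t"
  shows "tight G y s \<subseteq> tight G y t"
proof
  fix e assume "e \<in> tight G y s"
  then have "e \<in> Ed G" "load G y e s = cost G e" by (auto simp: tight_def)
  then show "e \<in> tight G y t"
    using load_mono[OF assms, of e] load_le_cost[of t e] assms by (auto simp: tight_def)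
qed

lemma load_cont: "continuous_on {0..} (load G y e)"
  unfolding load_def by (intro continuous_on_sum y_cont)

text \<open>Tight edges stay tight by \<open>tight_mono\<close>; an edge with spare cost keeps some
  of it for a short time by continuity.\<close>

lemma tight_right_const:
  assumes "t \<ge> 0"
  shows "eventually (\<lambda>s. tight G y s = tight G y t) (at_right t)"
proof -
  have "eventually (\<lambda>s. e \<in> tight G y s \<longleftrightarrow> e \<in> tight G y t) (at_right t)" if e: "e \<in> Ed G" for e
  proof (cases "e \<in> tight G y t")
    case True
    have "eventually (\<lambda>s. s > t) (at_right t)" by (simp add: eventually_at_right_less)
    then show ?thesis
      by eventually_elim (use True tight_mono[OF assms] in \<open>auto dest!: less_imp_le\<close>)
  next
    case False
    then have less: "load G y e t < cost G e" using load_le_cost[OF assms e] e by (auto simp: tight_def)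
    have "(load G y e \<longlongrightarrow> load G y e t) (at t within {0..})"
      using load_cont[of e] assms by (auto simp: continuous_on_def)
    then have "(load G y e \<longlongrightarrow> load G y e t) (at_right t)"
      by (rule tendsto_within_subset) (use assms in auto)
    then have "eventually (\<lambda>s. load G y e s < cost G e) (at_right t)"
      using less by (rule order_tendstoD)
    then show ?thesis by eventually_elim (use False in \<open>auto simp: tight_def\<close>)
  qed
  then have "eventually (\<lambda>s. \<forall>e\<in>Ed G. e \<in> tight G y s \<longleftrightarrow> e \<in> tight G y t) (at_right t)"
    using fin_E by (intro eventually_ball_finite) auto
  then show ?thesis by eventually_elim (use tight_sub in blast)
qed

text \<open>Right derivatives give continuity from the right. From the left it comes from the
  merging condition: while the tight edges do not change, the only component inside \<open>S\<close>
  is \<open>S\<close> itself.\<close>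

lemma b_continuous_on:
  assumes "0 \<le> a" and const: "\<And>s. a \<le> s \<Longrightarrow> s < c \<Longrightarrow> tight G y s = tight G y a"
    and S: "S \<in> comps_at G y a"
  shows "continuous_on {a..<c} (b S)"
proof -
  have comps: "comps_at G y s = comps_at G y a" if "a \<le> s" "s < c" for s
    using const[OF that] by (simp add: comps_at_def)
  have right: "(b S \<longlongrightarrow> b S x) (at x within {x..})" if x: "a \<le> x" "x < c" for x
  proof -
    have "S \<in> comps_at G y x" using comps[OF x] S by simp
    then have "continuous (at x within {x..}) (b S)"
      using b_deriv[of x S] x assms(1) by (intro DERIV_continuous) auto
    then show ?thesis unfolding continuous_within .
  qed
  have left: "(b S \<longlongrightarrow> b S x) (at_left x)" if x: "a < x" "x < c" for x
  proof -
    have "S \<in> comps_at G y x" using comps[of x] x S by simp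
    then have lim: "((\<lambda>s. \<Sum>T\<in>{T \<in> comps_at G y s. T \<subseteq> S}. b T s) \<longlongrightarrow> b S x) (at_left x)"
      using b_merge[of x S] x assms(1) by simp
    have only: "{T \<in> comps_at G y a. T \<subseteq> S} = {S}"
      using S comps_eq[of _ G "tight G y a" S] comps_nonempty[of _ G "tight G y a"] unfolding comps_at_def by blast
    have "eventually (\<lambda>s. s \<in> {a<..<x}) (at_left x)" using x(1) by (rule eventually_at_left_real)
    then have "eventually (\<lambda>s. (\<Sum>T\<in>{T \<in> comps_at G y s. T \<subseteq> S}. b T s) = b S s) (at_left x)"
    proof eventually_elim
      case (elim s)
      then have "comps_at G y s = comps_at G y a" using x by (intro comps) auto
      then show ?case using only by simp
    qed
    then show ?thesis using lim by (rule Lim_transform_eventually[rotated])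
  qed
  show ?thesis unfolding continuous_on_def
  proof
    fix x assume "x \<in> {a..<c}"
    then have x: "a \<le> x" "x < c" by auto
    show "(b S \<longlongrightarrow> b S x) (at x within {a..<c})"
    proof (cases "x = a")
      case True
      show ?thesis by (rule tendsto_within_subset[OF right[OF x]]) (use True in auto)
    next
      case False
      have "(b S \<longlongrightarrow> b S x) (at_right x)" by (rule tendsto_within_subset[OF right[OF x]]) auto
      then have "(b S \<longlongrightarrow> b S x) (at x)"
        using left[of x] False x by (simp add: filterlim_at_split)
      then show ?thesis by (rule tendsto_within_subset) auto
    qed
  qed
qed

lemma b_nonincreasing:
  assumes "0 \<le> a" "a \<le> s" "s < c" and const: "\<And>s. a \<le> s \<Longrightarrow> s < c \<Longrightarrow> tight G y s = tight G y a"
    and S: "S \<in> comps_at G y a" "\<not> demand_active G (tight G y a) S"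
  shows "b S s \<le> b S a"
proof (rule right_derivative_nonpos_le[OF assms(2)])
  show "continuous_on {a..s} (b S)"
    using b_continuous_on[OF assms(1) const S(1)] by (rule continuous_on_subset) (use assms(3) in auto)
  fix t assume t: "a \<le> t" "t < s"
  then have tt: "tight G y t = tight G y a" using assms(3) by (intro const) auto
  then have "S \<in> comps_at G y t" using S(1) by (simp add: comps_at_def)
  then have "(b S has_real_derivative (if budget_active G (tight G y t) b t S then -1 else 0)) (at t within {t..})"
    using b_deriv[of t S] t assms(1) S(2) tt by simp
  then show "\<exists>D\<le>0. (b S has_real_derivative D) (at t within {t..})"
    by (intro exI[of _ "if budget_active G (tight G y t) b t S then -1 else 0"]) simp
qed

text \<open>A positive budget stays positive for a short time. Without unmet demand a zero budget
  cannot become positive, because it never grows while the tight edges are fixed.\<close>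

lemma state_right_const:
  assumes t: "t \<ge> 0"
  shows "\<exists>c>t. \<forall>s. t \<le> s \<and> s < c \<longrightarrow> tight G y s = tight G y t \<and> active G y b s = active G y b t"
proof -
  obtain c0 where c0: "c0 > t" "\<And>s. t < s \<Longrightarrow> s < c0 \<Longrightarrow> tight G y s = tight G y t"
    using tight_right_const[OF t] by (auto simp: eventually_at_right_field)
  have c0': "tight G y s = tight G y t" if "t \<le> s" "s < c0" for s
    using c0(2)[of s] that by (cases "s = t") auto
  define F where "F = tight G y t"
  have "eventually (\<lambda>s. b C t > 0 \<longrightarrow> b C s > 0) (at_right t)" if C: "C \<in> comps G F" for C
  proof (cases "b C t > 0")
    case True
    have "C \<in> comps_at G y t" using C by (simp add: comps_at_def F_def)
    then have "continuous (at t within {t..}) (b C)"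
      using b_deriv[of t C] t by (intro DERIV_continuous) auto
    then have "(b C \<longlongrightarrow> b C t) (at_right t)"
      unfolding continuous_within by (rule tendsto_within_subset) auto
    then have "eventually (\<lambda>s. b C s > 0) (at_right t)" using True by (rule order_tendstoD)
    then show ?thesis by eventually_elim simp
  qed simp
  then have "eventually (\<lambda>s. \<forall>C\<in>comps G F. b C t > 0 \<longrightarrow> b C s > 0) (at_right t)"
    using comps_finite[OF wf_G] by (intro eventually_ball_finite) auto
  then obtain c1 where c1: "c1 > t" "\<And>s C. t < s \<Longrightarrow> s < c1 \<Longrightarrow> C \<in> comps G F \<Longrightarrow> b C t > 0 \<Longrightarrow> b C s > 0"
    by (auto simp: eventually_at_right_field)
  show ?thesis
  proof (intro exI[of _ "min c0 c1"] conjI allI impI)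
    show "min c0 c1 > t" using c0 c1 by simp
    fix s assume s: "t \<le> s \<and> s < min c0 c1"
    show ts: "tight G y s = tight G y t" by (rule c0') (use s in auto)
    have "b C s > 0 \<longleftrightarrow> b C t > 0" if C: "C \<in> comps G F" "\<not> demand_active G F C" for C
    proof
      assume "b C s > 0"
      moreover have "b C s \<le> b C t"
      proof (rule b_nonincreasing[OF t _ _ c0'])
        show "C \<in> comps_at G y t" "\<not> demand_active G (tight G y t) C"
          using C by (simp_all add: comps_at_def F_def)
      qed (use s in auto)
      ultimately show "b C t > 0" by simp
    next
      assume "b C t > 0"
      then show "b C s > 0" using c1(2)[of s C] s C by (cases "s = t") auto
    qed
    then show "active G y b s = active G y b t"
      unfolding active_def comps_at_def budget_active_def ts F_def[symmetric] by auto
  qed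
qed

lemma active_antimono:
  assumes "0 \<le> s" "s \<le> t" "tight G y s = tight G y t"
  shows "active G y b t \<subseteq> active G y b s"
proof
  fix C assume C: "C \<in> active G y b t"
  have "0 \<le> t" using assms(1,2) by simp
  \<comment> \<open>\<open>b_nonincreasing\<close> asks for constant tight edges slightly beyond
    \<open>t\<close>.\<close>
  then obtain c where c: "c > t" "\<And>r. t \<le> r \<Longrightarrow> r < c \<Longrightarrow> tight G y r = tight G y t"
    using state_right_const by blast
  have const: "tight G y r = tight G y s" if r: "s \<le> r" "r < c" for r
  proof (cases "r \<le> t")
    case True
    then show ?thesis using tight_mono[of s r] tight_mono[of r t] r assms by auto
  next
    case False
    then show ?thesis using c(2)[of r] r assms by auto
  qed
  have Cs: "C \<in> comps_at G y s" using C assms(3) by (auto simp: active_def comps_at_def)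
  show "C \<in> active G y b s"
  proof (cases "demand_active G (tight G y s) C")
    case True
    then show ?thesis using Cs by (simp add: active_def)
  next
    case False
    then have "b C t > 0" using C assms(3) by (auto simp: active_def budget_active_def)
    moreover have "b C t \<le> b C s" by (rule b_nonincreasing[OF assms(1,2) c(1) const Cs False])
    ultimately show ?thesis using Cs False by (simp add: active_def budget_active_def)
  qed
qed

lemma active_sub: "active G y b t \<subseteq> comps G (tight G y t)"
  by (auto simp: active_def comps_at_def)

lemma fin_active: "finite (active G y b t)"
  using active_sub comps_finite[OF wf_G] finite_subset by blast

text \<open>Lexicographic: tight edges only accumulate, and while they do not change, active components only
disappear. Hence the state changes finitely often.\<close>

definition potential :: "real \<Rightarrow> nat" where
  "potential t = (card (Ed G) - card (tight G y t)) * (card (V G) + 1) + card (active G y b t)"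

lemma card_active_le: "card (active G y b t) \<le> card (V G)"
proof -
  have "card (active G y b t) \<le> card (comps G (tight G y t))"
    by (rule card_mono[OF comps_finite[OF wf_G] active_sub])
  also have "\<dots> \<le> card (V G)" unfolding comps_def by (rule card_image_le[OF fin_V])
  finally show ?thesis .
qed

lemma potential_antimono:
  assumes "0 \<le> s" "s \<le> t"
  shows "potential t \<le> potential s \<and>
    (potential t = potential s \<longrightarrow> tight G y t = tight G y s \<and> active G y b t = active G y b s)"
proof (cases "tight G y s = tight G y t")
  case True
  have sub: "active G y b t \<subseteq> active G y b s" by (rule active_antimono[OF assms True])
  then have "card (active G y b t) \<le> card (active G y b s)" by (rule card_mono[OF fin_active])
  then show ?thesis using True card_subset_eq[OF fin_active sub] by (auto simp: potential_def)
next
  case False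
  have ft: "finite (tight G y t)" using tight_sub fin_E finite_subset by blast
  have "tight G y s \<subset> tight G y t" using tight_mono[OF assms] False by auto
  then have "card (tight G y s) < card (tight G y t)" by (rule psubset_card_mono[OF ft])
  moreover have "card (tight G y t) \<le> card (Ed G)" by (rule card_mono[OF fin_E tight_sub])
  ultimately have "card (Ed G) - card (tight G y s) \<ge> (card (Ed G) - card (tight G y t)) + 1" by linarith
  then have "(card (Ed G) - card (tight G y s)) * (card (V G) + 1)
      \<ge> ((card (Ed G) - card (tight G y t)) + 1) * (card (V G) + 1)" by (rule mult_le_mono1)
  \<comment> \<open>The factor \<open>card (V G) + 1\<close> exceeds any number of active
    components, so one new tight edge outweighs every change of activity.\<close>
  then have "potential t < potential s" using card_active_le[of t] by (simp add: potential_def)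
  then show ?thesis by simp
qed

definition same_state :: "real \<Rightarrow> real \<Rightarrow> bool" where
  "same_state s t \<longleftrightarrow> tight G y s = tight G y t \<and> active G y b s = active G y b t"

text \<open>Induction on the potential. The next phase starts at the infimum of the times with a
  different state: right constancy at \<open>t\<close> puts it after \<open>t\<close>, and right
  constancy at the infimum shows that the state already differs there.\<close>

lemma finite_phases:
  assumes "t \<ge> 0"
  shows "\<exists>N T. T 0 = t \<and> (\<forall>i<N. T i < T (Suc i) \<and> (\<forall>s. T i \<le> s \<and> s < T (Suc i) \<longrightarrow> same_state s (T i)))
    \<and> (\<forall>s\<ge>T N. same_state s (T N))"
  using assms
proof (induction "potential t" arbitrary: t rule: less_induct)
  case less
  show ?case
  proof (cases "\<forall>s\<ge>t. same_state s t")
    case True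
    then show ?thesis by (intro exI[of _ 0] exI[of _ "\<lambda>_. t"]) auto
  next
    case False
    define Z where "Z = {s. s \<ge> t \<and> \<not> same_state s t}"
    define t' where "t' = Inf Z"
    have ne: "Z \<noteq> {}" using False by (auto simp: Z_def)
    have bdd: "bdd_below Z" by (rule bdd_belowI[of _ t]) (auto simp: Z_def)
    obtain c where c: "c > t" "\<And>s. t \<le> s \<Longrightarrow> s < c \<Longrightarrow> same_state s t"
      using state_right_const[OF less.prems] unfolding same_state_def by blast
    have "c \<le> t'" unfolding t'_def
    proof (rule cInf_greatest[OF ne])
      fix x assume "x \<in> Z"
      then show "c \<le> x" using c(2)[of x] by (force simp: Z_def)
    qed
    then have t': "t < t'" "0 \<le> t'" using c(1) less.prems by auto
    have before: "same_state s t" if "t \<le> s" "s < t'" for s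
    proof (rule ccontr)
      assume "\<not> same_state s t"
      then have "s \<in> Z" using that by (simp add: Z_def)
      then have "t' \<le> s" unfolding t'_def by (rule cInf_lower[OF _ bdd])
      then show False using that by simp
    qed
    have "\<not> same_state t' t"
    proof
      assume st: "same_state t' t"
      obtain c' where c': "c' > t'" "\<And>s. t' \<le> s \<Longrightarrow> s < c' \<Longrightarrow> same_state s t'"
        using state_right_const[OF t'(2)] unfolding same_state_def by blast
      have "c' \<le> t'" unfolding t'_def
      proof (rule cInf_greatest[OF ne])
        fix x assume x: "x \<in> Z"
        show "c' \<le> x"
        proof (rule ccontr)
          assume "\<not> c' \<le> x"
          moreover have "t' \<le> x" unfolding t'_def by (rule cInf_lower[OF x bdd])
          ultimately have "same_state x t" using c'(2)[of x] st by (simp add: same_state_def)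
          then show False using x by (simp add: Z_def)
        qed
      qed
      then show False using c'(1) by simp
    qed
    then have "potential t' < potential t"
      using potential_antimono[of t t'] t' less.prems by (auto simp: same_state_def)
    from less.hyps[OF this t'(2)] obtain N T where NT: "T 0 = t'"
      "\<And>i. i < N \<Longrightarrow> T i < T (Suc i) \<and> (\<forall>s. T i \<le> s \<and> s < T (Suc i) \<longrightarrow> same_state s (T i))"
      "\<And>s. s \<ge> T N \<Longrightarrow> same_state s (T N)" by blast
    show ?thesis
    proof (intro exI[of _ "Suc N"] exI[of _ "case_nat t T"] conjI)
      show "\<forall>i<Suc N. case_nat t T i < case_nat t T (Suc i) \<and>
        (\<forall>s. case_nat t T i \<le> s \<and> s < case_nat t T (Suc i) \<longrightarrow> same_state s (case_nat t T i))"
      proof (intro allI impI)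
        fix i assume i: "i < Suc N"
        show "case_nat t T i < case_nat t T (Suc i) \<and>
          (\<forall>s. case_nat t T i \<le> s \<and> s < case_nat t T (Suc i) \<longrightarrow> same_state s (case_nat t T i))"
        proof (cases i)
          case 0
          then show ?thesis using NT(1) t' before by auto
        next
          case (Suc j)
          then show ?thesis using NT(2)[of j] i by auto
        qed
      qed
    qed (use NT in auto)
  qed
qed

end

section \<open>Evaluation of a run on its phases\<close>

locale moat_grid = moat_growing G eps y b + minimal_forest G OPT
  for G :: "('a, 'e) sf_inst" and eps y b OPT +
  fixes N :: nat and T :: "nat \<Rightarrow> real"
  assumes eps_positive: "eps > 0"
    and T_zero: "T 0 = 0"
    and T_step: "i < N \<Longrightarrow> T i < T (Suc i)"
    and T_same: "i < N \<Longrightarrow> T i \<le> s \<Longrightarrow> s < T (Suc i) \<Longrightarrow> same_state s (T i)"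
    and T_last: "T N \<le> s \<Longrightarrow> same_state s (T N)"
begin

abbreviation Act :: "nat \<Rightarrow> 'a set set" where
  "Act i \<equiv> active G y b (T i)"

abbreviation rate :: "nat \<Rightarrow> 'a set \<Rightarrow> real" where
  "rate i U \<equiv> if sep G U \<noteq> {} then eps else if U \<in> Act i then -1 else 0"

lemma T_mono: "i \<le> j \<Longrightarrow> j \<le> N \<Longrightarrow> T i \<le> T j"
proof (induction j)
  case (Suc j)
  then show ?case using T_step[of j] by (cases "i = Suc j") auto
qed simp

lemma T_nonneg: "i \<le> N \<Longrightarrow> T i \<ge> 0"
  using T_mono[of 0 i] T_zero by simp

lemma T_locate: "m \<le> N \<Longrightarrow> 0 \<le> s \<Longrightarrow> s < T m \<Longrightarrow> \<exists>j<m. T j \<le> s \<and> s < T (Suc j)"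
proof (induction m)
  case 0
  then show ?case using T_zero by simp
next
  case (Suc m)
  show ?case
  proof (cases "s < T m")
    case True
    then obtain j where "j < m" "T j \<le> s" "s < T (Suc j)" using Suc by auto
    then show ?thesis by (intro exI[of _ j]) auto
  next
    case False
    then show ?thesis using Suc.prems by (intro exI[of _ m]) auto
  qed
qed

lemma demand_iff: "U \<in> comps G (tight G y t) \<Longrightarrow> demand_active G (tight G y t) U \<longleftrightarrow> sep G U \<noteq> {}"
  by (rule demand_active_iff[OF wf tight_sub])

lemma active_iff: "U \<in> active G y b t \<longleftrightarrow> U \<in> comps G (tight G y t) \<and> (sep G U \<noteq> {} \<or> b U t > 0)"
  using demand_iff[of U t] by (auto simp: active_def comps_at_def budget_active_def)

lemma b_rate:
  assumes "t \<ge> 0" "U \<in> comps G (tight G y t)"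
  shows "(b U has_real_derivative (if sep G U \<noteq> {} then eps else if U \<in> active G y b t then -1 else 0)) (at t within {t..})"
proof -
  have U: "U \<in> comps_at G y t" using assms(2) by (simp add: comps_at_def)
  have "budget_active G (tight G y t) b t U \<longleftrightarrow> sep G U = {} \<and> U \<in> active G y b t"
    using demand_iff[OF assms(2)] active_iff[of U t] assms(2) by (auto simp: budget_active_def)
  then show ?thesis using b_deriv[OF assms(1) U] demand_iff[OF assms(2)] by (simp split: if_splits)
qed

lemma b_linear:
  assumes "0 \<le> a" "a \<le> s" "s < c" "\<And>t. a \<le> t \<Longrightarrow> t < c \<Longrightarrow> same_state t a" "U \<in> comps G (tight G y a)"
  shows "b U s = b U a + (if sep G U \<noteq> {} then eps else if U \<in> active G y b a then -1 else 0) * (s - a)"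
proof (rule right_derivative_const_linear[OF assms(2)])
  have "continuous_on {a..<c} (b U)"
  proof (rule b_continuous_on[OF assms(1)])
    show "tight G y t = tight G y a" if "a \<le> t" "t < c" for t using assms(4)[OF that] by (simp add: same_state_def)
    show "U \<in> comps_at G y a" using assms(5) by (simp add: comps_at_def)
  qed
  then show "continuous_on {a..s} (b U)" by (rule continuous_on_subset) (use assms(3) in auto)
  fix t assume t: "a \<le> t" "t < s"
  then have ss: "tight G y t = tight G y a" "active G y b t = active G y b a"
    using assms(4)[of t] assms(3) by (simp_all add: same_state_def)
  show "(b U has_real_derivative (if sep G U \<noteq> {} then eps else if U \<in> active G y b a then -1 else 0)) (at t within {t..})"
    using b_rate[of t U] t(1) assms(1,5) unfolding ss by (meson order_trans)
qed

text \<open>When the phase ends, \<open>U\<close> may cease to be a component, so the accumulated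
  budget is expressed as a left limit and not as a value of \<open>b U\<close>.\<close>

lemma b_left_limit:
  assumes "i < N" "U \<in> comps G (tight G y (T i))"
  shows "(b U \<longlongrightarrow> b U (T i) + (T (Suc i) - T i) * rate i U) (at_left (T (Suc i)))"
proof -
  have "((\<lambda>s. b U (T i) + rate i U * (s - T i)) \<longlongrightarrow> b U (T i) + rate i U * (T (Suc i) - T i)) (at_left (T (Suc i)))"
    by (intro tendsto_intros)
  moreover have "eventually (\<lambda>s. s \<in> {T i<..<T (Suc i)}) (at_left (T (Suc i)))"
    using T_step[OF assms(1)] by (rule eventually_at_left_real)
  then have "eventually (\<lambda>s. b U (T i) + rate i U * (s - T i) = b U s) (at_left (T (Suc i)))"
  proof eventually_elim
    case (elim s)
    have "0 \<le> T i" using assms(1) by (intro T_nonneg) simp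
    then have "b U s = b U (T i) + rate i U * (s - T i)"
      using elim by (intro b_linear[OF _ _ _ T_same[OF assms(1)] assms(2)]) auto
    then show ?case by (rule sym)
  qed
  ultimately have "(b U \<longlongrightarrow> b U (T i) + rate i U * (T (Suc i) - T i)) (at_left (T (Suc i)))"
    by (rule Lim_transform_eventually)
  then show ?thesis by (simp only: mult.commute)
qed

text \<open>Both sides are left limits of the same sum, one by the merging condition and one by the
  linear course of budgets within a phase.\<close>

lemma budget_merge:
  assumes "i < N" "U' \<in> comps G (tight G y (T (Suc i)))"
  shows "b U' (T (Suc i)) = (\<Sum>U\<in>{U \<in> comps G (tight G y (T i)). U \<subseteq> U'}. b U (T i) + (T (Suc i) - T i) * rate i U)"
proof (rule tendsto_unique[of "at_left (T (Suc i))"])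
  have pos: "T (Suc i) > 0" using T_step[OF assms(1)] T_nonneg[of i] assms(1) by simp
  show "((\<lambda>s. \<Sum>U\<in>{U \<in> comps_at G y s. U \<subseteq> U'}. b U s) \<longlongrightarrow> b U' (T (Suc i))) (at_left (T (Suc i)))"
    using b_merge[OF pos] assms(2) by (simp add: comps_at_def)
  have "((\<lambda>s. \<Sum>U\<in>{U \<in> comps G (tight G y (T i)). U \<subseteq> U'}. b U s) \<longlongrightarrow>
      (\<Sum>U\<in>{U \<in> comps G (tight G y (T i)). U \<subseteq> U'}. b U (T i) + (T (Suc i) - T i) * rate i U)) (at_left (T (Suc i)))"
    using b_left_limit[OF assms(1)] by (intro tendsto_sum) auto
  moreover have "eventually (\<lambda>s. s \<in> {T i<..<T (Suc i)}) (at_left (T (Suc i)))"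
    using T_step[OF assms(1)] by (rule eventually_at_left_real)
  then have "eventually (\<lambda>s. (\<Sum>U\<in>{U \<in> comps G (tight G y (T i)). U \<subseteq> U'}. b U s)
      = (\<Sum>U\<in>{U \<in> comps_at G y s. U \<subseteq> U'}. b U s)) (at_left (T (Suc i)))"
  proof eventually_elim
    case (elim s)
    then have "tight G y s = tight G y (T i)" using T_same[OF assms(1), of s] by (simp add: same_state_def)
    then show ?case by (simp add: comps_at_def)
  qed
  ultimately show "((\<lambda>s. \<Sum>U\<in>{U \<in> comps_at G y s. U \<subseteq> U'}. b U s) \<longlongrightarrow>
      (\<Sum>U\<in>{U \<in> comps G (tight G y (T i)). U \<subseteq> U'}. b U (T i) + (T (Suc i) - T i) * rate i U)) (at_left (T (Suc i)))"
    by (rule Lim_transform_eventually)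
qed simp

text \<open>The active family is constant during the phase, so a budget-active component keeps a
  positive budget in its interior, and the bound passes to the left limit.\<close>

lemma budget_end_nonneg:
  assumes "i < N" "U \<in> comps G (tight G y (T i))" "b U (T i) \<ge> 0"
  shows "b U (T i) + (T (Suc i) - T i) * rate i U \<ge> 0"
proof (cases "sep G U = {} \<and> U \<in> Act i")
  case True
  have "eventually (\<lambda>s. s \<in> {T i<..<T (Suc i)}) (at_left (T (Suc i)))"
    using T_step[OF assms(1)] by (rule eventually_at_left_real)
  then have "eventually (\<lambda>s. 0 \<le> b U s) (at_left (T (Suc i)))"
  proof eventually_elim
    case (elim s)
    then have "active G y b s = Act i" using T_same[OF assms(1), of s] by (simp add: same_state_def)
    then show ?case using active_iff[of U s] True by auto
  qed
  then show ?thesis using tendsto_lowerbound[OF b_left_limit[OF assms(1,2)]] by simp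
next
  case False
  then show ?thesis using assms(3) eps_positive T_step[OF assms(1)] by auto
qed

lemma budget_nonneg: "i \<le> N \<Longrightarrow> U \<in> comps G (tight G y (T i)) \<Longrightarrow> b U (T i) \<ge> 0"
proof (induction i arbitrary: U)
  case 0
  then show ?case using b_zero[of U] T_zero by (simp add: comps_at_def)
next
  case (Suc i)
  have "i < N" using Suc.prems by simp
  then show ?case unfolding budget_merge[OF \<open>i < N\<close> Suc.prems(2)]
    using Suc.IH by (intro sum_nonneg budget_end_nonneg) auto
qed

lemma y_nonneg: "t \<ge> 0 \<Longrightarrow> y S t \<ge> 0"
  using y_mono[of 0 t S] y_zero by simp

lemma y_linear:
  assumes "0 \<le> a" "a \<le> c" "\<And>s. a \<le> s \<Longrightarrow> s < c \<Longrightarrow> same_state s a"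
  shows "y S c = y S a + (if S \<in> active G y b a then c - a else 0)"
proof -
  have "y S c = y S a + (if S \<in> active G y b a then 1 else 0) * (c - a)"
  proof (rule right_derivative_const_linear[OF assms(2)])
    show "continuous_on {a..c} (y S)" by (rule continuous_on_subset[OF y_cont]) (use assms in auto)
    fix t assume t: "a \<le> t" "t < c"
    then have "active G y b t = active G y b a" using assms(3)[OF t] by (simp add: same_state_def)
    then show "(y S has_real_derivative (if S \<in> active G y b a then 1 else 0)) (at t within {t..})"
      using y_deriv[of t S] t assms(1) by simp
  qed
  then show ?thesis by simp
qed

text \<open>A component active forever would, with unmet demand, overload an OPT edge leaving it;
  without unmet demand its budget is used up after the time \<open>b C (T N)\<close>.\<close>

lemma active_last: "Act N = {}"
proof (rule ccontr)
  assume "Act N \<noteq> {}"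
  then obtain C where C: "C \<in> Act N" by blast
  then have Cc: "C \<in> comps G (tight G y (T N))" using active_sub by blast
  have TN: "T N \<ge> 0" by (rule T_nonneg) simp
  show False
  proof (cases "sep G C = {}")
    case False
    then have "deg C \<noteq> 0" using deg_pos_of_sep by fastforce
    then have "delta G C \<inter> OPT \<noteq> {}" unfolding deg_def by (metis card.empty)
    then obtain e where e: "e \<in> delta G C" "e \<in> Ed G" using OPT_sub by blast
    define s where "s = T N + cost G e + 1"
    have "cost G e \<ge> 0" using wf e(2) by (simp add: wf_inst_def)
    then have s: "T N \<le> s" "0 \<le> s" using TN by (auto simp: s_def)
    have "y C s = y C (T N) + (s - T N)" using y_linear[OF TN s(1) T_last, of C] C by simp
    then have "cost G e < y C s" using y_nonneg[OF TN, of C] by (simp add: s_def)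
    also have "y C s \<le> load G y e s"
      unfolding load_def using e(1) comps_sub[OF Cc] fin_V y_nonneg[OF s(2)]
      by (intro member_le_sum) auto
    finally show False using load_le_cost[OF s(2) e(2)] by simp
  next
    case True
    define s where "s = T N + b C (T N)"
    have "b C (T N) > 0" using C True active_iff by blast
    then have s: "T N \<le> s" by (simp add: s_def)
    have "b C s = b C (T N) + (-1) * (s - T N)"
      using b_linear[OF TN s _ T_last Cc, of "s + 1"] C True by simp
    then have "b C s = 0" by (simp add: s_def)
    moreover have "C \<in> active G y b s" using T_last[OF s] C by (simp add: same_state_def)
    ultimately show False using True active_iff[of C s] by simp
  qed
qed

lemma y_grid:
  assumes "n \<le> N"
  shows "y S (T n) = (\<Sum>i<n. if S \<in> Act i then T (Suc i) - T i else 0)"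
  using assms
proof (induction n)
  case 0
  then show ?case using y_zero T_zero by simp
next
  case (Suc n)
  have n: "n < N" using Suc.prems by simp
  have "T n \<le> T (Suc n)" using T_step[OF n] by simp
  then have "y S (T (Suc n)) = y S (T n) + (if S \<in> Act n then T (Suc n) - T n else 0)"
    using n by (intro y_linear[OF T_nonneg _ T_same[OF n]]) auto
  then show ?case using Suc by simp
qed

lemma yinf_grid: "yinf y S = (\<Sum>i<N. if S \<in> Act i then T (Suc i) - T i else 0)"
proof -
  have TN: "T N \<ge> 0" by (rule T_nonneg) simp
  have "y S (T N) = y S s" if "T N \<le> s" for s
    using y_linear[OF TN that T_last, of S] active_last by simp
  then have "eventually (\<lambda>s. y S (T N) = y S s) at_top"
    by (rule eventually_mono[OF eventually_ge_at_top[of "T N"]])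
  then have "(y S \<longlongrightarrow> y S (T N)) at_top"
    by (rule Lim_transform_eventually[OF tendsto_const])
  then have "yinf y S = y S (T N)" unfolding yinf_def by (intro tendsto_Lim) auto
  then show ?thesis using y_grid[of N] by simp
qed

lemma sum_yinf:
  assumes "finite X"
  shows "(\<Sum>U\<in>X. yinf y U) = (\<Sum>i<N. (T (Suc i) - T i) * card {U \<in> Act i. U \<in> X})"
proof -
  have "(\<Sum>U\<in>X. yinf y U) = (\<Sum>i<N. \<Sum>U\<in>X. if U \<in> Act i then T (Suc i) - T i else 0)"
    unfolding yinf_grid by (rule sum.swap)
  also have "\<dots> = (\<Sum>i<N. (T (Suc i) - T i) * card {U \<in> Act i. U \<in> X})"
  proof (rule sum.cong[OF refl])
    fix i
    have "X \<inter> {U. U \<in> Act i} = {U \<in> Act i. U \<in> X}" by auto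
    then show "(\<Sum>U\<in>X. if U \<in> Act i then T (Suc i) - T i else 0) = (T (Suc i) - T i) * card {U \<in> Act i. U \<in> X}"
      using assms by (simp add: sum.If_cases)
  qed
  finally show ?thesis .
qed

lemma Act_sub_V: "U \<in> Act i \<Longrightarrow> U \<subseteq> V G"
  using active_sub comps_sub by blast

lemma Act_supp:
  assumes "i < N" "U \<in> Act i"
  shows "U \<in> supp G y"
proof -
  have "0 < (\<Sum>j<N. if U \<in> Act j then T (Suc j) - T j else 0)"
  proof (rule sum_pos2[of _ i])
    show "0 \<le> (if U \<in> Act j then T (Suc j) - T j else 0)" if "j \<in> {..<N}" for j
      using T_step[of j] that by simp
  qed (use assms T_step[OF assms(1)] in auto)
  then show ?thesis using Act_sub_V[OF assms(2)] unfolding supp_def yinf_grid by simp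
qed

text \<open>The predicate is left open so that both the separating sets and the covered sets turn
  into sums over phases.\<close>

lemma ysum_grid: "ysum y {U \<in> supp G y. Q U} = (\<Sum>i<N. (T (Suc i) - T i) * card {U \<in> Act i. Q U})"
proof -
  have "finite (supp G y)" using fin_V by (simp add: supp_def)
  then have "ysum y {U \<in> supp G y. Q U} = (\<Sum>i<N. (T (Suc i) - T i) * card {U \<in> Act i. U \<in> {U \<in> supp G y. Q U}})"
    unfolding ysum_def by (intro sum_yinf) simp
  also have "\<dots> = (\<Sum>i<N. (T (Suc i) - T i) * card {U \<in> Act i. Q U})"
  proof (rule sum.cong[OF refl])
    fix i assume "i \<in> {..<N}"
    then have "{U \<in> Act i. U \<in> {U \<in> supp G y. Q U}} = {U \<in> Act i. Q U}" using Act_supp by auto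
    then show "(T (Suc i) - T i) * card {U \<in> Act i. U \<in> {U \<in> supp G y. Q U}} = (T (Suc i) - T i) * card {U \<in> Act i. Q U}"
      by simp
  qed
  finally show ?thesis .
qed

lemma load_grid:
  assumes "e \<in> Ed G"
  shows "(\<Sum>i<N. (T (Suc i) - T i) * card {U \<in> Act i. e \<in> delta G U}) \<le> cost G e"
proof -
  have fin: "finite {S. S \<subseteq> V G \<and> e \<in> delta G S}" using fin_V by simp
  have yy: "yinf y S = y S (T N)" for S using yinf_grid y_grid[of N] by simp
  have "{U \<in> Act i. U \<in> {S. S \<subseteq> V G \<and> e \<in> delta G S}} = {U \<in> Act i. e \<in> delta G U}" for i
    using Act_sub_V by auto
  then have "(\<Sum>i<N. (T (Suc i) - T i) * card {U \<in> Act i. e \<in> delta G U}) = load G y e (T N)"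
    using sum_yinf[OF fin] by (simp add: load_def yy)
  then show ?thesis using load_le_cost[OF T_nonneg[of N] assms] by simp
qed

sublocale phases: moat_phases G OPT "\<lambda>i. tight G y (T i)" Act "\<lambda>i. T (Suc i) - T i" "\<lambda>i U. b U (T i)" N eps
proof
  show "tight G y (T i) \<subseteq> Ed G" for i by (rule tight_sub)
  show "tight G y (T i) \<subseteq> tight G y (T j)" if "i \<le> j" "j \<le> N" for i j
    using that T_nonneg[of i] T_mono by (intro tight_mono) auto
  show "Act i \<subseteq> comps G (tight G y (T i))" for i by (rule active_sub)
  show "U \<in> Act i" if "U \<in> comps G (tight G y (T i))" "sep G U \<noteq> {}" for i U
    using that active_iff by blast
  show "U \<in> Act i" if "U \<in> comps G (tight G y (T i))" "0 < b U (T i)" for i U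
    using that active_iff by blast
  show "0 < T (Suc i) - T i" if "i < N" for i using T_step[OF that] by simp
  show "0 \<le> b U (T i) + (T (Suc i) - T i) * rate i U" if "i < N" "U \<in> comps G (tight G y (T i))" for i U
    using budget_end_nonneg[OF that] budget_nonneg[of i U] that by simp
qed (use active_last eps_positive budget_nonneg budget_merge load_grid in blast)+

text \<open>The witness time is the start \<open>T m\<close> of the first phase in which the tree is
  whole. Core vertices are awake in all earlier phases, so none is deactivated before
  \<open>T m\<close>.\<close>

lemma core_actively_connected: "actively_connected G y b (phases.core W)"
  unfolding actively_connected_def
proof (intro ballI)
  fix u v assume uv: "u \<in> phases.core W" "v \<in> phases.core W"
  define m where "m = (LEAST m. phases.whole m W)"
  have ex: "\<exists>m\<le>N. phases.whole m W" using uv(1) by (auto simp: phases.core_def split: if_splits)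
  then obtain m' where m': "m' \<le> N" "phases.whole m' W" by blast
  have m: "phases.whole m W" "m \<le> N"
    unfolding m_def using m' LeastI[of "\<lambda>m. phases.whole m W" m'] Least_le[of "\<lambda>m. phases.whole m W" m'] by auto
  have nw: "\<not> phases.whole j W" if "j < m" for j using not_less_Least that unfolding m_def by blast
  have deact: "ereal (T m) \<le> deact G y b x" if x: "x \<in> phases.core W" for x
    unfolding deact_def
  proof (rule SUP_upper, intro CollectI conjI allI impI)
    show "0 \<le> T m" by (rule T_nonneg[OF m(2)])
    fix s assume s: "0 \<le> s \<and> s < T m"
    then obtain j where j: "j < m" "T j \<le> s" "s < T (Suc j)" using T_locate[OF m(2)] by blast
    have "phases.awake j x" using x nw[OF j(1)] j(1) m(2) by (auto simp: phases.core_def split: if_splits)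
    then have "\<exists>C\<in>Act j. x \<in> C" by (simp add: phases.awake_def)
    moreover have "active G y b s = Act j" using T_same[of j s] j m(2) by (simp add: same_state_def)
    ultimately show "\<exists>C\<in>active G y b s. x \<in> C" by simp
  qed
  obtain U where "U \<in> comps G (tight G y (T m))" "W \<subseteq> U" using m(1) by (auto simp: phases.whole_def)
  then have "\<exists>C\<in>comps_at G y (T m). u \<in> C \<and> v \<in> C" using uv phases.core_sub unfolding comps_at_def by blast
  then show "act_rel G y b u v"
    unfolding act_rel_def using deact uv T_nonneg[OF m(2)] by (intro exI[of _ "T m"]) auto
qed

lemma pairs_crossing_free: "crossing_free_autarkic G y b phases.pairs"
  unfolding crossing_free_autarkic_def
proof (intro conjI ballI impI)
  fix P assume "P \<in> phases.pairs"
  then obtain W where W: "W \<in> trees" "phases.paired W" "P = phases.pair W" by (auto simp: phases.pairs_def)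
  obtain i U1 U2 where U: "i < N" "phases.pair W = {U1, U2}" "U1 \<inter> U2 = {}"
    "sep G U1 = sep G U2" "sep G U1 \<noteq> {}" "U1 \<in> Act i" "U2 \<in> Act i"
    using phases.pairedE[OF W(1,2)] by metis
  have "coactive G y b {U1, U2}"
    unfolding coactive_def using U T_nonneg[of i] by (intro exI[of _ "T i"]) auto
  then have "autarkic_pair G y b P"
    unfolding autarkic_pair_def using U W(3) Act_supp by (intro exI[of _ U1] exI[of _ U2]) auto
  then show "autarkic_pair G y b P \<or> autarkic_triple G y b P" ..
next
  fix P Q assume "P \<in> phases.pairs" "Q \<in> phases.pairs" "P \<noteq> Q"
  then obtain W W' where W: "W \<in> trees" "phases.paired W" "P = phases.pair W"
    "W' \<in> trees" "phases.paired W'" "Q = phases.pair W'" "W \<noteq> W'"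
    by (auto simp: phases.pairs_def)
  show "psep G P \<inter> psep G Q = {}"
    unfolding W(3,6) by (rule phases.psep_pair_disjoint[OF W(1,2,4,5,7)])
qed

text \<open>The integrand is a step function on the phases and vanishes from \<open>T N\<close> on,
  where nothing is active.\<close>

lemma gain_grid:
  "gain G y b S = 2 * (\<Sum>i<N. (T (Suc i) - T i) * (real (card (Act i)) - real (card (merged (Act i) S))))"
proof -
  define h where "h t = real (card (active G y b t)) - real (card (merged (active G y b t) S))" for t
  have eq: "indicator {0..} t *\<^sub>R h t = (\<Sum>i<N. h (T i) * indicator {T i..<T (Suc i)} t)" for t
  proof -
    have in_phase: "h t = h (T i)" if "i < N" "T i \<le> t" "t < T (Suc i)" for i
      using T_same[OF that] by (simp add: h_def same_state_def)
    consider "t < 0" | "T N \<le> t" | "0 \<le> t" "t < T N" by linarith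
    then show ?thesis
    proof cases
      case 1
      have "t < T i" if "i < N" for i using T_nonneg[of i] that 1 by simp
      then have "(\<Sum>i<N. h (T i) * indicator {T i..<T (Suc i)} t) = 0"
        by (intro sum.neutral) (auto simp: indicator_def dest: leD)
      then show ?thesis using 1 by simp
    next
      case 2
      have "active G y b t = {}" using T_last[OF 2] active_last by (simp add: same_state_def)
      then have "h t = 0" by (simp add: h_def merged_def quotient_def)
      moreover have "T (Suc i) \<le> t" if "i < N" for i using T_mono[of "Suc i" N] that 2 by simp
      then have "(\<Sum>i<N. h (T i) * indicator {T i..<T (Suc i)} t) = 0"
        by (intro sum.neutral) (auto simp: indicator_def dest: leD)
      ultimately show ?thesis by simp
    next
      case 3
      obtain j where j: "j < N" "T j \<le> t" "t < T (Suc j)" using T_locate[OF le_refl 3] by blast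
      have "\<not> (T i \<le> t \<and> t < T (Suc i))" if "i < N" "i \<noteq> j" for i
      proof (cases "i < j")
        case True
        then have "T (Suc i) \<le> T j" using j(1) by (intro T_mono) auto
        then show ?thesis using j by simp
      next
        case False
        then have "T (Suc j) \<le> T i" using that by (intro T_mono) auto
        then show ?thesis using j by simp
      qed
      then have "(\<Sum>i<N. h (T i) * indicator {T i..<T (Suc i)} t) = (\<Sum>i\<in>{j}. h (T i) * indicator {T i..<T (Suc i)} t)"
        using j(1) by (intro sum.mono_neutral_right) (auto simp: indicator_def)
      then show ?thesis using 3 j in_phase[OF j] by simp
    qed
  qed
  have int: "integrable lborel (\<lambda>t. h (T i) * indicator {T i..<T (Suc i)} t :: real)" if "i < N" for i
    using T_step[OF that] by (intro integrable_mult_right integrable_real_indicator) auto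
  have "set_lebesgue_integral lborel {0..} h = (\<integral>t. (\<Sum>i<N. h (T i) * indicator {T i..<T (Suc i)} t) \<partial>lborel)"
    unfolding set_lebesgue_integral_def eq ..
  also have "\<dots> = (\<Sum>i<N. \<integral>t. h (T i) * indicator {T i..<T (Suc i)} t \<partial>lborel)"
    by (rule Bochner_Integration.integral_sum) (use int in auto)
  also have "\<dots> = (\<Sum>i<N. (T (Suc i) - T i) * h (T i))"
    using T_step by (intro sum.cong) (auto simp: less_imp_le)
  finally show ?thesis unfolding gain_def h_def by simp
qed

theorem gain_coverage_excess_bound:
  fixes rep :: "'a set set \<Rightarrow> 'a set"
  assumes rep: "\<forall>A B. A \<noteq> B \<and> sep G A \<inter> sep G B \<noteq> {} \<longrightarrow> rep {A, B} \<in> sep G A \<inter> sep G B"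
  shows "\<exists>\<S> \<P>. (\<forall>S\<in>\<S>. actively_connected G y b S) \<and> crossing_free_autarkic G y b \<P>
     \<and> 10/3 * (gain G y b \<S> - cost_coll G \<S>) + (2 * coverage G y \<P> - connector_cost G rep \<P>)
       + (1 / (2 * eps) + 17) * excess G y OPT \<ge> ysum y (Usep G y)"
proof (intro exI[of _ phases.cores] exI[of _ phases.pairs] conjI ballI pairs_crossing_free)
  show "actively_connected G y b S" if "S \<in> phases.cores" for S
    using that core_actively_connected by (auto simp: phases.cores_def)
  have "ysum y (Usep G y) = (\<Sum>i<N. (T (Suc i) - T i) * card {U \<in> Act i. sep G U \<noteq> {}})"
    unfolding Usep_def by (rule ysum_grid)
  moreover have "coverage G y phases.pairs = (\<Sum>i<N. (T (Suc i) - T i) * card (phases.covered i))"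
    unfolding coverage_def phases.covered_def by (rule ysum_grid)
  ultimately show "ysum y (Usep G y) \<le> 10/3 * (gain G y b phases.cores - cost_coll G phases.cores)
      + (2 * coverage G y phases.pairs - connector_cost G rep phases.pairs)
      + (1 / (2 * eps) + 17) * excess G y OPT"
    using phases.phases_bound[OF rep] by (simp add: gain_grid excess_def)
qed

end

theorem theorem5p1:
  fixes G :: "('a, 'e) sf_inst" and eps :: real
    and y b :: "'a set \<Rightarrow> real \<Rightarrow> real"
    and OPT :: "'e set" and rep :: "'a set set \<Rightarrow> 'a set"
  assumes "wf_inst G"
    and "eps > 0"
    and "moat_run G eps y b"
    and "feasible G OPT"
    and "\<forall>F. feasible G F \<longrightarrow> cset G OPT \<le> cset G F"
    and "\<forall>e\<in>OPT. cost G e = 0 \<longrightarrow> \<not> feasible G (OPT - {e})"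
    and "\<forall>A B. A \<noteq> B \<and> sep G A \<inter> sep G B \<noteq> {} \<longrightarrow> rep {A, B} \<in> sep G A \<inter> sep G B"
  shows "\<exists>\<S> \<P>. (\<forall>S\<in>\<S>. actively_connected G y b S) \<and> crossing_free_autarkic G y b \<P>
     \<and> 10/3 * (gain G y b \<S> - cost_coll G \<S>) + (2 * coverage G y \<P> - connector_cost G rep \<P>)
       + (1 / (2 * eps) + 17) * excess G y OPT \<ge> ysum y (Usep G y)"
proof -
  interpret moat_growing G eps y b using assms(1,3) by unfold_locales
  interpret minimal_forest G OPT
  proof
    fix e assume e: "e \<in> OPT"
    have fin: "finite OPT" and eE: "e \<in> Ed G"
      using assms(1,4) e by (auto simp: feasible_def wf_inst_def intro: finite_subset)
    show "\<not> feasible G (OPT - {e})"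
    proof
      \<comment> \<open>A removable edge of cost 0 contradicts inclusionwise minimality, one of
        positive cost contradicts optimality.\<close>
      assume f: "feasible G (OPT - {e})"
      then have "cost G e \<noteq> 0" using assms(6) e by blast
      moreover have "cost G e \<ge> 0" using assms(1) eE by (simp add: wf_inst_def)
      ultimately have "cost G e > 0" by simp
      moreover have "cset G OPT = cost G e + cset G (OPT - {e})"
        unfolding cset_def by (rule sum.remove[OF fin e])
      ultimately show False using assms(5) f by fastforce
    qed
  qed (use assms in auto)
  obtain N T where "T 0 = 0"
    "\<forall>i<N. T i < T (Suc i) \<and> (\<forall>s. T i \<le> s \<and> s < T (Suc i) \<longrightarrow> same_state s (T i))"
    "\<forall>s\<ge>T N. same_state s (T N)"
    using finite_phases[OF order_refl] by blast
  then interpret moat_grid G eps y b OPT N T using assms(2) by unfold_locales auto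
  show ?thesis by (rule gain_coverage_excess_bound[OF assms(7)])
qed

end
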